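(* Let $(P,[\cdot_\lambda\cdot],\cdot_\lambda\cdot)$ be a Poisson conformal algebra in which $P$ is free as a $\mathbf k[\partial]$-module and let $r=\sum_ir_i\otimes l_i\in P\otimes P$ be skew-symmetric ($\tau r=-r$, where $\tau(u\otimes v)=v\otimes u$). Let $T^r\in\mathrm{Chom}(P^{\ast c},P)$ be given by $T^r_\lambda(f)=\sum_if_{-\lambda-\partial^P}(r_i)\,l_i$ for $f\in P^{\ast c}$. Then $r$ is a solution of the Poisson conformal Yang-Baxter equation (PCYBE) in $P$ if and only if $T^r_0=T^r_\lambda|_{\lambda=0}$ is an $\mathcal O$-operator on the Poisson conformal algebra $(P,[\cdot_\lambda\cdot],\cdot_\lambda\cdot)$ associated with the representation $(P^{\ast c},\mathfrak{ad}_P^\ast,-\mathfrak L_P^\ast)$.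
   Context: Let $\mathbf k$ be a field of characteristic $0$. All $\mathbf k[\partial]$-modules are assumed finitely generated; $\otimes$ is over $\mathbf k$, $I$ is the identity. An associative conformal algebra is a $\mathbf k[\partial]$-module $P$ with a $\mathbf k$-bilinear map $P\times P\to P[\lambda]$, $(a,b)\mapsto a_\lambda b$, with $(\partial a)_\lambda b=-\lambda a_\lambda b$, $a_\lambda(\partial b)=(\partial+\lambda)a_\lambda b$, $(a_\lambda b)_{\lambda+\mu}c=a_\lambda(b_\mu c)$; it is commutative if $a_\lambda b=b_{-\lambda-\partial}a$. (If $b_\nu a=\sum_k\nu^kc_k$, then $b_{-\lambda-\partial}a=\sum_k(-\lambda-\partial)^kc_k$; similarly for other substitutions.) A Lie conformal algebra is a $\mathbf k[\partial]$-module $P$ with a $\mathbf k$-bilinear map $[\cdot_\lambda\cdot]:P\times P\to P[\lambda]$ with $[(\partial a)_\lambda b]=-\lambda[a_\lambda b]$, $[a_\lambda(\partial b)]=(\partial+\lambda)[a_\lambda b]$, $[a_\lambda b]=-[b_{-\lambda-\partial}a]$, $[a_\lambda[b_\mu c]]=[[a_\lambda b]_{\lambda+\mu}c]+[b_\mu[a_\lambda c]]$. A Poisson conformal algebra $(P,[\cdot_\lambda\cdot],\cdot_\lambda\cdot)$ is both a Lie conformal algebra and a commutative associative conformal algebra such that $[a_\lambda(b_\mu c)]=[a_\lambda b]_{\lambda+\mu}c+b_\mu[a_\lambda c]$. A conformal linear map $f:U\to V$ of $\mathbf k[\partial]$-modules is a $\mathbf k$-linear map $f_\lambda:U\to V[\lambda]$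 with $f_\lambda(\partial u)=(\partial+\lambda)f_\lambda u$; they form a $\mathbf k[\partial]$-module $\mathrm{Chom}(U,V)$ with $(\partial f)_\lambda=-\lambda f_\lambda$; $\mathrm{gc}(V)=\mathrm{Chom}(V,V)$; $U^{\ast c}=\mathrm{Chom}(U,\mathbf k)$ with $\mathbf k$ the trivial module. In $f_{-\lambda-\partial^P}(r_i)\,l_i$, the polynomial $f_\nu(r_i)\in\mathbf k[\nu]$ is evaluated at $\nu=-\lambda-\partial^P$, where $\partial^P$ is the action of $\partial$ on $P$, and applied to $l_i$. A representation of a Poisson conformal algebra $P$ is a triple $(V,\rho_P,l_P)$, with $V$ a $\mathbf k[\partial]$-module and $\rho_P,l_P:P\to\mathrm{gc}(V)$ $\mathbf k[\partial]$-module homomorphisms, such that $\rho_P([a_\lambda b])_{\lambda+\mu}v=\rho_P(a)_\lambda(\rho_P(b)_\mu v)-\rho_P(b)_\mu(\rho_P(a)_\lambda v)$, $l_P(a_\lambda b)_{\lambda+\mu}v=l_P(a)_\lambda(l_P(b)_\mu v)$, $\rho_P(a_\mu b)_{-\lambda-\partial}v=l_P(b)_{-\lambda-\mu-\partial}(\rho_P(a)_{-\lambda-\partial}v)+l_P(a)_\mu(\rho_P(b)_{-\lambda-\partial}v)$ and $\rho_P(a)_\lambda(l_P(b)_\mu v)=l_P([a_\lambda b])_{\lambda+\mu}v+l_P(b)_\mu(\rho_P(a)_\lambda v)$. For $\varphi:P\to\mathrm{gc}(V)$, $\varphi^\ast:P\to\mathrm{gc}(V^{\ast c})$ is $(\varphi^\ast(a)_\lambda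 f)_\mu u=-f_{\mu-\lambda}(\varphi(a)_\lambda u)$. Here $\mathfrak{ad}_P(a)_\lambda b=[a_\lambda b]$, $\mathfrak L_P(a)_\lambda b=a_\lambda b$; $(P^{\ast c},\mathfrak{ad}_P^\ast,-\mathfrak L_P^\ast)$ is a representation of $P$. An $\mathcal O$-operator on $P$ associated with a representation $(V,\rho_P,l_P)$ is a $\mathbf k[\partial]$-module homomorphism $T:V\to P$ with $T(u)_\lambda T(v)=T(l_P(T(u))_\lambda v)+T(l_P(T(v))_{-\lambda-\partial}u)$ and $[T(u)_\lambda T(v)]=T(\rho_P(T(u))_\lambda v)-T(\rho_P(T(v))_{-\lambda-\partial}u)$ for all $u,v\in V$. Put $\partial^{\otimes^2}=\partial\otimes I+I\otimes\partial$, $\partial^{\otimes^3}=\partial\otimes I\otimes I+I\otimes\partial\otimes I+I\otimes I\otimes\partial$. For $r=\sum_ir_i\otimes l_i\in P\otimes P$: $[[r,r]]=\sum_{i,j}\big([{r_i}_\mu r_j]\otimes l_i\otimes l_j|_{\mu=I\otimes\partial\otimes I}-r_i\otimes[{r_j}_\mu l_i]\otimes l_j|_{\mu=I\otimes I\otimes\partial}-r_i\otimes r_j\otimes[{l_j}_\mu l_i]|_{\mu=I\otimes\partial\otimes I}\big)$, $r\bullet r=\sum_{i,j}\big(r_i\otimes r_j\otimes{l_i}_\mu l_j|_{\mu=\partial\otimes I\otimes I}-r_i\otimes{r_j}_\mu l_i\otimes l_j|_{\mu=-\partial^{\otimes^2}\otimes I}+{r_i}_\mu r_j\otimes l_i\otimes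 l_j|_{\mu=I\otimes\partial\otimes I}\big)$, where a substitution means that the polynomial in $\mu$ acts on the tensor coefficients through the given operator. $r$ is a solution of the PCYBE in $P$ if both $[[r,r]]$ and $r\bullet r$ lie in $\partial^{\otimes^3}(P\otimes P\otimes P)$. *)

theory Defs
  imports
    Complex_Main
    "HOL-Computational_Algebra.Polynomial"
    "HOL-Library.Function_Algebras"
    "HOL-Library.Poly_Mapping"
begin

section \<open>Modules over $k[\partial]$ and polynomials with coefficients in them\<close>

text \<open>
  The ring $k[\partial]$ is the type \<open>'k poly\<close>, acting by \<open>act\<close> on a type; so
  \<open>act [:0, 1:]\<close> is $\partial$ and \<open>act [:c:]\<close> is the scalar $c \in k$. The carrier \<open>V\<close> is
  needed because $U^{*c}$ is a proper submodule of the type of all functions \<open>'u \<Rightarrow> 'k poly\<close>.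
\<close>

locale kd_module = module act
  for act :: "'k::field_char_0 poly \<Rightarrow> 'v::ab_group_add \<Rightarrow> 'v" +
  fixes V :: "'v set"
  assumes submodule: "subspace V"
    and finitely_generated: "\<exists>B. finite B \<and> span B = V"

abbreviation kd_del :: "('k::field_char_0 poly \<Rightarrow> 'v \<Rightarrow> 'v) \<Rightarrow> 'v \<Rightarrow> 'v" where
  "kd_del act \<equiv> act [:0, 1:]"

definition kd_free :: "('k::field_char_0 poly \<Rightarrow> 'v::ab_group_add \<Rightarrow> 'v) \<Rightarrow> bool" where
  "kd_free act \<longleftrightarrow> (\<exists>B. \<not> module.dependent act B \<and> module.span act B = UNIV)"

text \<open>
  Substitution: for $p = \sum_k \nu^k p_k$, the value $\sum_k A^k (h\, p_k)$ in an arbitrary target,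
  where \<open>A\<close> is the operator that replaces the variable $\nu$ and \<open>h\<close> embeds (or further processes)
  the coefficients.
\<close>

definition psubst :: "('w \<Rightarrow> 'w) \<Rightarrow> ('v \<Rightarrow> 'w) \<Rightarrow> 'v::zero poly \<Rightarrow> 'w::comm_monoid_add" where
  "psubst A h p = (\<Sum>k\<le>degree p. (A ^^ k) (h (coeff p k)))"

text \<open>
  $V[\lambda]$ is \<open>'v poly\<close>; the operators below are multiplication by $\lambda$, the coefficientwise
  action of $\partial$, and the embedding of $V$. The operators are combined pointwise
  with \<open>+\<close> and \<open>-\<close>, and iterated by \<open>^^\<close>.
\<close>

abbreviation lam1 :: "'v::zero poly \<Rightarrow> 'v poly" where
  "lam1 \<equiv> pCons 0"
abbreviation del1 :: "('k::field_char_0 poly \<Rightarrow> 'v \<Rightarrow> 'v) \<Rightarrow> 'v::zero poly \<Rightarrow> 'v poly" where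
  "del1 act \<equiv> map_poly (kd_del act)"
abbreviation emb1 :: "'v::zero \<Rightarrow> 'v poly" where
  "emb1 x \<equiv> [:x:]"

text \<open>
  $V[\lambda,\mu] = V[\lambda][\mu]$ is \<open>'v poly poly\<close>, with $\mu$ the outer and $\lambda$ the inner variable.
\<close>

abbreviation lam2 :: "'v::zero poly poly \<Rightarrow> 'v poly poly" where
  "lam2 \<equiv> map_poly (pCons 0)"
abbreviation mu2 :: "'v::zero poly poly \<Rightarrow> 'v poly poly" where
  "mu2 \<equiv> pCons 0"
abbreviation del2 :: "('k::field_char_0 poly \<Rightarrow> 'v \<Rightarrow> 'v) \<Rightarrow> 'v::zero poly poly \<Rightarrow> 'v poly poly" where
  "del2 act \<equiv> map_poly (map_poly (kd_del act))"
abbreviation emb2 :: "'v::zero \<Rightarrow> 'v poly poly" where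
  "emb2 x \<equiv> [:[:x:]:]"


section \<open>Poisson conformal algebras\<close>

text \<open>
  For \<open>mul a b\<close> read $a_\lambda b$. For example, $(a_\lambda b)_{\lambda+\mu} c$ is
  \<open>psubst lam2 (\<lambda>x. psubst (lam2 + mu2) emb2 (mul x c)) (mul a b)\<close>: if
  $a_\lambda b = \sum_k \lambda^k x_k$, this is $\sum_k \lambda^k ({x_k}_{\lambda+\mu} c)$.
\<close>

locale conformal_product = kd_module act UNIV
  for act :: "'k::field_char_0 poly \<Rightarrow> 'p::ab_group_add \<Rightarrow> 'p" +
  fixes mul :: "'p \<Rightarrow> 'p \<Rightarrow> 'p poly"
  assumes add_left: "mul (a + a') b = mul a b + mul a' b"
    and add_right: "mul a (b + b') = mul a b + mul a b'"
    and scalar_left: "mul (act [:c:] a) b = map_poly (act [:c:]) (mul a b)"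
    and scalar_right: "mul a (act [:c:] b) = map_poly (act [:c:]) (mul a b)"
    and del_left: "mul (kd_del act a) b = - lam1 (mul a b)"
    and del_right: "mul a (kd_del act b) = (del1 act + lam1) (mul a b)"

locale comm_assoc_conformal_algebra = conformal_product act mul
  for act :: "'k::field_char_0 poly \<Rightarrow> 'p::ab_group_add \<Rightarrow> 'p" and mul +
  assumes assoc:
      "psubst lam2 (\<lambda>x. psubst (lam2 + mu2) emb2 (mul x c)) (mul a b)
        = psubst mu2 (\<lambda>y. psubst lam2 emb2 (mul a y)) (mul b c)"
    and comm: "mul a b = psubst (- lam1 - del1 act) emb1 (mul b a)"

locale lie_conformal_algebra = conformal_product act br
  for act :: "'k::field_char_0 poly \<Rightarrow> 'p::ab_group_add \<Rightarrow> 'p" and br +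
  assumes skew: "br a b = - psubst (- lam1 - del1 act) emb1 (br b a)"
    and jacobi:
      "psubst mu2 (\<lambda>y. psubst lam2 emb2 (br a y)) (br b c)
        = psubst lam2 (\<lambda>x. psubst (lam2 + mu2) emb2 (br x c)) (br a b)
          + psubst lam2 (\<lambda>y. psubst mu2 emb2 (br b y)) (br a c)"

locale poisson_conformal_algebra =
  lie_conformal_algebra act br + comm_assoc_conformal_algebra act mul
  for act :: "'k::field_char_0 poly \<Rightarrow> 'p::ab_group_add \<Rightarrow> 'p" and br mul +
  assumes leibniz:
    "psubst mu2 (\<lambda>y. psubst lam2 emb2 (br a y)) (mul b c)
      = psubst lam2 (\<lambda>x. psubst (lam2 + mu2) emb2 (mul x c)) (br a b)
        + psubst lam2 (\<lambda>y. psubst mu2 emb2 (mul b y)) (br a c)"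


section \<open>Conformal linear maps and representations\<close>

definition chom :: "('k::field_char_0 poly \<Rightarrow> 'u::ab_group_add \<Rightarrow> 'u) \<Rightarrow> 'u set \<Rightarrow>
    ('k poly \<Rightarrow> 'v::ab_group_add \<Rightarrow> 'v) \<Rightarrow> 'v set \<Rightarrow> ('u \<Rightarrow> 'v poly) set" where
  "chom actU U actV V = {f.
     (\<forall>u\<in>U. \<forall>n. coeff (f u) n \<in> V) \<and>
     (\<forall>u\<in>U. \<forall>u'\<in>U. f (u + u') = f u + f u') \<and>
     (\<forall>c. \<forall>u\<in>U. f (actU [:c:] u) = map_poly (actV [:c:]) (f u)) \<and>
     (\<forall>u\<in>U. f (kd_del actU u) = (del1 actV + lam1) (f u))}"

text \<open>
  $(\partial f)_\lambda = -\lambda f_\lambda$, that is, $(p(\partial) f)_\lambda u = p(-\lambda) f_\lambda u$.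
\<close>

definition chom_act :: "('k::field_char_0 poly \<Rightarrow> 'v::ab_group_add \<Rightarrow> 'v) \<Rightarrow>
    'k poly \<Rightarrow> ('u \<Rightarrow> 'v poly) \<Rightarrow> 'u \<Rightarrow> 'v poly" where
  "chom_act actV p f = (\<lambda>u. psubst (- lam1) (\<lambda>c. map_poly (actV [:c:]) (f u)) p)"

definition triv_act :: "'k::field_char_0 poly \<Rightarrow> 'k \<Rightarrow> 'k" where
  "triv_act p x = poly p 0 * x"

definition cdual :: "('k::field_char_0 poly \<Rightarrow> 'u::ab_group_add \<Rightarrow> 'u) \<Rightarrow> 'u set \<Rightarrow>
    ('u \<Rightarrow> 'k poly) set" where
  "cdual actU U = chom actU U triv_act UNIV"

abbreviation cdual_act :: "'k::field_char_0 poly \<Rightarrow> ('u \<Rightarrow> 'k poly) \<Rightarrow> 'u \<Rightarrow> 'k poly" where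
  "cdual_act \<equiv> chom_act triv_act"

text \<open>
  Functions in \<open>chom actV V actV V\<close> represent elements of $\mathrm{gc}(V)$; only their values
  on \<open>V\<close> matter, so identities in $\mathrm{gc}(V)$ are stated on \<open>V\<close>.
\<close>

definition gc_hom :: "('k::field_char_0 poly \<Rightarrow> 'p::ab_group_add \<Rightarrow> 'p) \<Rightarrow>
    ('k poly \<Rightarrow> 'v::ab_group_add \<Rightarrow> 'v) \<Rightarrow> 'v set \<Rightarrow> ('p \<Rightarrow> 'v \<Rightarrow> 'v poly) \<Rightarrow> bool" where
  "gc_hom act actV V \<phi> \<longleftrightarrow>
     (\<forall>a. \<phi> a \<in> chom actV V actV V) \<and>
     (\<forall>a b. \<forall>v\<in>V. \<phi> (a + b) v = \<phi> a v + \<phi> b v) \<and>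
     (\<forall>p a. \<forall>v\<in>V. \<phi> (act p a) v = chom_act actV p (\<phi> a) v)"

text \<open>
  In the third axiom of a representation, substitutions involving $\partial$ are nested:
  the inner \<open>- lam1 - del1 actV\<close> acts on $V[\lambda]$ before the outer operation is applied
  to the coefficients.
\<close>

locale poisson_representation =
  P: poisson_conformal_algebra act br mul + V: kd_module actV V
  for act :: "'k::field_char_0 poly \<Rightarrow> 'p::ab_group_add \<Rightarrow> 'p" and br mul
    and actV :: "'k poly \<Rightarrow> 'v::ab_group_add \<Rightarrow> 'v" and V +
  fixes \<rho> l :: "'p \<Rightarrow> 'v \<Rightarrow> 'v poly"
  assumes rho_hom: "gc_hom act actV V \<rho>"
    and l_hom: "gc_hom act actV V l"
    and rho_bracket: "v \<in> V \<Longrightarrow>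
      psubst lam2 (\<lambda>x. psubst (lam2 + mu2) emb2 (\<rho> x v)) (br a b)
        = psubst mu2 (\<lambda>w. psubst lam2 emb2 (\<rho> a w)) (\<rho> b v)
          - psubst lam2 (\<lambda>w. psubst mu2 emb2 (\<rho> b w)) (\<rho> a v)"
    and l_prod: "v \<in> V \<Longrightarrow>
      psubst lam2 (\<lambda>x. psubst (lam2 + mu2) emb2 (l x v)) (mul a b)
        = psubst mu2 (\<lambda>w. psubst lam2 emb2 (l a w)) (l b v)"
    and rho_prod: "v \<in> V \<Longrightarrow>
      psubst mu2 (\<lambda>x. psubst (- lam2 - del2 actV) emb2 (\<rho> x v)) (mul a b)
        = psubst lam2 (\<lambda>w. psubst (- lam2 - mu2 - del2 actV) emb2 (l b w))
            (psubst (- lam1 - del1 actV) emb1 (\<rho> a v))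
          + psubst lam2 (\<lambda>w. psubst mu2 emb2 (l a w))
            (psubst (- lam1 - del1 actV) emb1 (\<rho> b v))"
    and rho_l: "v \<in> V \<Longrightarrow>
      psubst mu2 (\<lambda>w. psubst lam2 emb2 (\<rho> a w)) (l b v)
        = psubst lam2 (\<lambda>x. psubst (lam2 + mu2) emb2 (l x v)) (br a b)
          + psubst lam2 (\<lambda>w. psubst mu2 emb2 (l b w)) (\<rho> a v)"

text \<open>
  $\varphi^*$: \<open>gc_dual_value \<phi> a f u\<close> is $-f_{\mu-\lambda}(\varphi(a)_\lambda u) \in k[\lambda,\mu]$.
  The coefficient of $\lambda^n$ in $\varphi^*(a)_\lambda f$ is the function
  taking \<open>u\<close> to the coefficient of $\lambda^n$ therein, a polynomial in $\mu$.
  The use of \<open>Abs_poly\<close> is justified for conformal linear \<open>f\<close> and \<open>\<phi> a\<close>: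
  $f_{\mu-\lambda}(\varphi(a)_\lambda \partial u) = \mu f_{\mu-\lambda}(\varphi(a)_\lambda u)$, so the
  degree in $\lambda$ is bounded independently of \<open>u\<close> when the module is finitely generated.
\<close>

definition gc_dual_value ::
    "('p \<Rightarrow> 'v \<Rightarrow> 'v poly) \<Rightarrow> 'p \<Rightarrow> ('v::zero \<Rightarrow> 'k::field_char_0 poly) \<Rightarrow> 'v \<Rightarrow> 'k poly poly" where
  "gc_dual_value \<phi> a f u = - psubst lam2 (\<lambda>w. psubst (mu2 - lam2) emb2 (f w)) (\<phi> a u)"

definition gc_dual ::
    "('p \<Rightarrow> 'v \<Rightarrow> 'v poly) \<Rightarrow> 'p \<Rightarrow> ('v::zero \<Rightarrow> 'k::field_char_0 poly) \<Rightarrow> ('v \<Rightarrow> 'k poly) poly" where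
  "gc_dual \<phi> a f = Abs_poly (\<lambda>n u. map_poly (\<lambda>q. coeff q n) (gc_dual_value \<phi> a f u))"


section \<open>O-operators\<close>

definition kd_hom_on :: "('k::field_char_0 poly \<Rightarrow> 'v::ab_group_add \<Rightarrow> 'v) \<Rightarrow> 'v set \<Rightarrow>
    ('k poly \<Rightarrow> 'p::ab_group_add \<Rightarrow> 'p) \<Rightarrow> ('v \<Rightarrow> 'p) \<Rightarrow> bool" where
  "kd_hom_on actV V act T \<longleftrightarrow>
     (\<forall>u\<in>V. \<forall>v\<in>V. T (u + v) = T u + T v) \<and>
     (\<forall>p. \<forall>v\<in>V. T (actV p v) = act p (T v))"

definition o_operator ::
    "('k::field_char_0 poly \<Rightarrow> 'p::ab_group_add \<Rightarrow> 'p) \<Rightarrow> ('p \<Rightarrow> 'p \<Rightarrow> 'p poly) \<Rightarrow> ('p \<Rightarrow> 'p \<Rightarrow> 'p poly) \<Rightarrow>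
     ('k poly \<Rightarrow> 'v::ab_group_add \<Rightarrow> 'v) \<Rightarrow> 'v set \<Rightarrow> ('p \<Rightarrow> 'v \<Rightarrow> 'v poly) \<Rightarrow> ('p \<Rightarrow> 'v \<Rightarrow> 'v poly) \<Rightarrow>
     ('v \<Rightarrow> 'p) \<Rightarrow> bool" where
  "o_operator act br mul actV V \<rho> l T \<longleftrightarrow>
     poisson_representation act br mul actV V \<rho> l \<and>
     kd_hom_on actV V act T \<and>
     (\<forall>u\<in>V. \<forall>v\<in>V.
        mul (T u) (T v) = map_poly T (l (T u) v)
          + map_poly T (psubst (- lam1 - del1 actV) emb1 (l (T v) u))) \<and>
     (\<forall>u\<in>V. \<forall>v\<in>V.
        br (T u) (T v) = map_poly T (\<rho> (T u) v)
          - map_poly T (psubst (- lam1 - del1 actV) emb1 (\<rho> (T v) u)))"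


section \<open>Tensor powers and the Poisson conformal Yang-Baxter equation\<close>

text \<open>
  $P \otimes P$ and $P \otimes P \otimes P$ are the quotients of the vector spaces
  of formal $k$-linear combinations of pairs and triples by the subspaces of multilinearity relations.
  Elements are given by representatives, and equality is congruence modulo these subspaces.
\<close>

definition fscale :: "'k::field_char_0 \<Rightarrow> ('b \<Rightarrow>\<^sub>0 'k) \<Rightarrow> 'b \<Rightarrow>\<^sub>0 'k" where
  "fscale c t = Poly_Mapping.map ((*) c) t"

text \<open>The $k$-linear extension of a map of basis elements.\<close>

definition flift :: "('b \<Rightarrow> 'c) \<Rightarrow> ('b \<Rightarrow>\<^sub>0 'k::field_char_0) \<Rightarrow> 'c \<Rightarrow>\<^sub>0 'k" where
  "flift g t = (\<Sum>b\<in>Poly_Mapping.keys t. Poly_Mapping.single (g b) (Poly_Mapping.lookup t b))"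

definition tens2 :: "'p \<Rightarrow> 'p \<Rightarrow> ('p \<times> 'p) \<Rightarrow>\<^sub>0 'k::field_char_0" where
  "tens2 a b = Poly_Mapping.single (a, b) 1"

definition tens3 :: "'p \<Rightarrow> 'p \<Rightarrow> 'p \<Rightarrow> ('p \<times> 'p \<times> 'p) \<Rightarrow>\<^sub>0 'k::field_char_0" where
  "tens3 a b c = Poly_Mapping.single (a, b, c) 1"

definition tens2_rel :: "('k::field_char_0 poly \<Rightarrow> 'p::ab_group_add \<Rightarrow> 'p) \<Rightarrow> (('p \<times> 'p) \<Rightarrow>\<^sub>0 'k) set" where
  "tens2_rel act = module.span fscale (
     {tens2 (a + a') b - tens2 a b - tens2 a' b | a a' b. True} \<union>
     {tens2 a (b + b') - tens2 a b - tens2 a b' | a b b'. True} \<union>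
     {tens2 (act [:k:] a) b - fscale k (tens2 a b) | k a b. True} \<union>
     {tens2 a (act [:k:] b) - fscale k (tens2 a b) | k a b. True})"

definition tens3_rel ::
    "('k::field_char_0 poly \<Rightarrow> 'p::ab_group_add \<Rightarrow> 'p) \<Rightarrow> (('p \<times> 'p \<times> 'p) \<Rightarrow>\<^sub>0 'k) set" where
  "tens3_rel act = module.span fscale (
     {tens3 (a + a') b c - tens3 a b c - tens3 a' b c | a a' b c. True} \<union>
     {tens3 a (b + b') c - tens3 a b c - tens3 a b' c | a b b' c. True} \<union>
     {tens3 a b (c + c') - tens3 a b c - tens3 a b c' | a b c c'. True} \<union>
     {tens3 (act [:k:] a) b c - fscale k (tens3 a b c) | k a b c. True} \<union>
     {tens3 a (act [:k:] b) c - fscale k (tens3 a b c) | k a b c. True} \<union>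
     {tens3 a b (act [:k:] c) - fscale k (tens3 a b c) | k a b c. True})"

definition tens2_eq :: "('k::field_char_0 poly \<Rightarrow> 'p::ab_group_add \<Rightarrow> 'p) \<Rightarrow>
    (('p \<times> 'p) \<Rightarrow>\<^sub>0 'k) \<Rightarrow> (('p \<times> 'p) \<Rightarrow>\<^sub>0 'k) \<Rightarrow> bool" where
  "tens2_eq act s t \<longleftrightarrow> s - t \<in> tens2_rel act"

definition tens3_eq :: "('k::field_char_0 poly \<Rightarrow> 'p::ab_group_add \<Rightarrow> 'p) \<Rightarrow>
    (('p \<times> 'p \<times> 'p) \<Rightarrow>\<^sub>0 'k) \<Rightarrow> (('p \<times> 'p \<times> 'p) \<Rightarrow>\<^sub>0 'k) \<Rightarrow> bool" where
  "tens3_eq act s t \<longleftrightarrow> s - t \<in> tens3_rel act"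

text \<open>The operators $\partial\otimes I\otimes I$, $I\otimes\partial\otimes I$, $I\otimes I\otimes\partial$.\<close>

definition dII :: "('k::field_char_0 poly \<Rightarrow> 'p \<Rightarrow> 'p) \<Rightarrow> (('p \<times> 'p \<times> 'p) \<Rightarrow>\<^sub>0 'k) \<Rightarrow> ('p \<times> 'p \<times> 'p) \<Rightarrow>\<^sub>0 'k" where
  "dII act = flift (\<lambda>(a, b, c). (kd_del act a, b, c))"
definition IdI :: "('k::field_char_0 poly \<Rightarrow> 'p \<Rightarrow> 'p) \<Rightarrow> (('p \<times> 'p \<times> 'p) \<Rightarrow>\<^sub>0 'k) \<Rightarrow> ('p \<times> 'p \<times> 'p) \<Rightarrow>\<^sub>0 'k" where
  "IdI act = flift (\<lambda>(a, b, c). (a, kd_del act b, c))"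
definition IId :: "('k::field_char_0 poly \<Rightarrow> 'p \<Rightarrow> 'p) \<Rightarrow> (('p \<times> 'p \<times> 'p) \<Rightarrow>\<^sub>0 'k) \<Rightarrow> ('p \<times> 'p \<times> 'p) \<Rightarrow>\<^sub>0 'k" where
  "IId act = flift (\<lambda>(a, b, c). (a, b, kd_del act c))"

text \<open>An element $r = \sum_{i \in I} r_i \otimes l_i$ is given by the finite families \<open>r\<close>, \<open>l\<close>.\<close>

definition skew_symmetric_tensor ::
    "('k::field_char_0 poly \<Rightarrow> 'p::ab_group_add \<Rightarrow> 'p) \<Rightarrow> 'i set \<Rightarrow> ('i \<Rightarrow> 'p) \<Rightarrow> ('i \<Rightarrow> 'p) \<Rightarrow> bool" where
  "skew_symmetric_tensor act I r l \<longleftrightarrow>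
     tens2_eq act (flift prod.swap (\<Sum>i\<in>I. tens2 (r i) (l i))) (- (\<Sum>i\<in>I. tens2 (r i) (l i)))"

definition yb_bracket :: "('k::field_char_0 poly \<Rightarrow> 'p::ab_group_add \<Rightarrow> 'p) \<Rightarrow> ('p \<Rightarrow> 'p \<Rightarrow> 'p poly) \<Rightarrow>
    'i set \<Rightarrow> ('i \<Rightarrow> 'p) \<Rightarrow> ('i \<Rightarrow> 'p) \<Rightarrow> ('p \<times> 'p \<times> 'p) \<Rightarrow>\<^sub>0 'k" where
  "yb_bracket act br I r l = (\<Sum>i\<in>I. \<Sum>j\<in>I.
       psubst (IdI act) (\<lambda>x. tens3 x (l i) (l j)) (br (r i) (r j))
     - psubst (IId act) (\<lambda>x. tens3 (r i) x (l j)) (br (r j) (l i))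
     - psubst (IdI act) (\<lambda>x. tens3 (r i) (r j) x) (br (l j) (l i)))"

definition yb_prod :: "('k::field_char_0 poly \<Rightarrow> 'p::ab_group_add \<Rightarrow> 'p) \<Rightarrow> ('p \<Rightarrow> 'p \<Rightarrow> 'p poly) \<Rightarrow>
    'i set \<Rightarrow> ('i \<Rightarrow> 'p) \<Rightarrow> ('i \<Rightarrow> 'p) \<Rightarrow> ('p \<times> 'p \<times> 'p) \<Rightarrow>\<^sub>0 'k" where
  "yb_prod act mul I r l = (\<Sum>i\<in>I. \<Sum>j\<in>I.
       psubst (dII act) (\<lambda>x. tens3 (r i) (r j) x) (mul (l i) (l j))
     - psubst (- (dII act + IdI act)) (\<lambda>x. tens3 (r i) x (l j)) (mul (r j) (l i))
     + psubst (IdI act) (\<lambda>x. tens3 x (l i) (l j)) (mul (r i) (r j)))"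

definition in_del_tens3 :: "('k::field_char_0 poly \<Rightarrow> 'p::ab_group_add \<Rightarrow> 'p) \<Rightarrow>
    (('p \<times> 'p \<times> 'p) \<Rightarrow>\<^sub>0 'k) \<Rightarrow> bool" where
  "in_del_tens3 act s \<longleftrightarrow> (\<exists>t. tens3_eq act s ((dII act + IdI act + IId act) t))"

definition pcybe_solution :: "('k::field_char_0 poly \<Rightarrow> 'p::ab_group_add \<Rightarrow> 'p) \<Rightarrow>
    ('p \<Rightarrow> 'p \<Rightarrow> 'p poly) \<Rightarrow> ('p \<Rightarrow> 'p \<Rightarrow> 'p poly) \<Rightarrow> 'i set \<Rightarrow> ('i \<Rightarrow> 'p) \<Rightarrow> ('i \<Rightarrow> 'p) \<Rightarrow> bool" where
  "pcybe_solution act br mul I r l \<longleftrightarrow>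
     in_del_tens3 act (yb_bracket act br I r l) \<and> in_del_tens3 act (yb_prod act mul I r l)"

text \<open>$T^r_\lambda(f) = \sum_i f_{-\lambda-\partial}(r_i)\, l_i \in P[\lambda]$\<close>

definition T_of :: "('k::field_char_0 poly \<Rightarrow> 'p::ab_group_add \<Rightarrow> 'p) \<Rightarrow>
    'i set \<Rightarrow> ('i \<Rightarrow> 'p) \<Rightarrow> ('i \<Rightarrow> 'p) \<Rightarrow> ('p \<Rightarrow> 'k poly) \<Rightarrow> 'p poly" where
  "T_of act I r l f =
     (\<Sum>i\<in>I. psubst (- lam1 - del1 act) (\<lambda>c. emb1 (act [:c:] (l i))) (f (r i)))"

end

theory Submission
  imports Defs
begin

text \<open>
  Every identity in question is an identity between polynomials in commuting variables with
  coefficients in a \<open>k[\<partial>]\<close>-module, and because \<open>k\<close> is infinite it may be checked after the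
  variables are given values in \<open>k\<close> and the coefficients are mapped to \<open>k\<close>. The right maps are the
  eigenfunctionals of weight \<open>\<gamma>\<close>: the \<open>k\<close>-linear \<open>\<phi>\<close> with \<open>\<phi> (\<partial> x) = \<gamma> \<phi> x\<close>. Under such a \<open>\<phi>\<close> a
  substitution like \<open>-\<lambda>-\<partial>\<close> becomes the scalar \<open>-\<lambda>-\<gamma>\<close>. For \<open>f\<close> in the conformal dual,
  \<open>f\<^sub>\<gamma>\<close> is an eigenfunctional of weight \<open>\<gamma>\<close> on \<open>P\<close>, and since \<open>P\<close> is free these separate the points
  of \<open>P\<close> (\<open>cdual_separates\<close>). On the dual, \<open>f \<mapsto> f\<^sub>x(u)\<close> is an eigenfunctional of weight \<open>-x\<close>.
  Moreover \<open>x \<mapsto> \<phi>(x\<^sub>s b)\<close> and \<open>y \<mapsto> \<phi>(a\<^sub>s y)\<close> are again eigenfunctionals, of weights \<open>-s\<close> and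
  \<open>s+\<gamma>\<close>, so the axioms can be used inside nested products.

  Both sides of the equivalence are compared in this way. An element of \<open>P\<otimes>P\<otimes>P\<close> lies in the image of
  \<open>\<partial>\<otimes>I\<otimes>I + I\<otimes>\<partial>\<otimes>I + I\<otimes>I\<otimes>\<partial>\<close> if and only if \<open>f\<^sub>\<alpha>\<otimes>g\<^sub>\<beta>\<otimes>h\<^sub>\<gamma>\<close> kills it for all \<open>f, g, h\<close> in the dual and all
  scalars with \<open>\<alpha>+\<beta>+\<gamma> = 0\<close> (\<open>pair3_in_del_tens3\<close>, \<open>in_del_tens3I\<close>): modulo the image, \<open>\<partial>\<close> can be
  moved away from the third factor, and what remains is a polynomial in \<open>\<alpha>\<close> and \<open>\<beta>\<close> for each triple
  of basis elements. On the other side, \<open>h\<^sub>\<gamma>(T f) = \<Sum>\<^sub>i f\<^sub>-\<^sub>\<gamma>(r\<^sub>i) h\<^sub>\<gamma>(l\<^sub>i)\<close>. Evaluating the two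
  identities for \<open>T\<close> at \<open>\<lambda> = \<alpha>\<close> under \<open>h\<^sub>\<gamma>\<close> gives three contractions of \<open>r\<otimes>r\<close> with a product, and
  skew-symmetry of \<open>r\<close> together with (skew-)commutativity of the product turns them into the three
  terms of \<open>[[r,r]]\<close> and of \<open>r\<bullet>r\<close> (\<open>yb_bracket_eval\<close>, \<open>yb_prod_eval\<close>).

  The other requirements on an \<open>\<O>\<close>-operator always hold: \<open>T\<close> is \<open>k[\<partial>]\<close>-linear (\<open>T_hom\<close>), and the dual
  carries a representation (\<open>coadjoint_representation\<close>), whose axioms, once evaluated, are the Jacobi,
  associative and Leibniz laws applied below a functional.
\<close>

section \<open>Evaluation at scalars\<close>

text \<open>
  These are the module homomorphisms to \<open>k\<close> on which \<open>\<partial>\<close> acts as the scalar \<open>\<gamma>\<close>.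
\<close>
definition eigenfunctional ::
    "('k::field_char_0 poly \<Rightarrow> 'v::ab_group_add \<Rightarrow> 'v) \<Rightarrow> 'k \<Rightarrow> ('v \<Rightarrow> 'k) \<Rightarrow> bool" where
  "eigenfunctional act \<gamma> \<phi> \<longleftrightarrow> additive \<phi> \<and> (\<forall>p x. \<phi> (act p x) = poly p \<gamma> * \<phi> x)"

text \<open>
  For \<open>\<phi> 0 = 0\<close> this is \<open>poly (map_poly \<phi> q) s\<close>, written as a sum so that exchanging two nested
  evaluations is a plain exchange of summations.
\<close>
definition evalp :: "('v::zero \<Rightarrow> 'k) \<Rightarrow> 'k::field_char_0 \<Rightarrow> 'v poly \<Rightarrow> 'k" where
  "evalp \<phi> s q = (\<Sum>k\<le>degree q. s ^ k * \<phi> (coeff q k))"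

lemma evalp_bound:
  assumes "\<phi> 0 = 0" "degree q \<le> n"
  shows "evalp \<phi> s q = (\<Sum>k\<le>n. s ^ k * \<phi> (coeff q k))"
  unfolding evalp_def
  by (rule sum.mono_neutral_left) (use assms in \<open>auto simp: coeff_eq_0\<close>)

lemma evalp_poly:
  assumes "\<phi> 0 = 0"
  shows "evalp \<phi> s q = poly (map_poly \<phi> q) s"
proof -
  have "poly (map_poly \<phi> q) s = (\<Sum>k\<le>degree q. coeff (map_poly \<phi> q) k * s ^ k)"
    unfolding poly_altdef
    by (rule sum.mono_neutral_left) (auto simp: coeff_eq_0 map_poly_degree_leq)
  then show ?thesis
    by (simp add: evalp_def coeff_map_poly assms mult.commute)
qed

lemma evalp_zero [simp]: "\<phi> 0 = 0 \<Longrightarrow> evalp \<phi> s 0 = 0"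
  by (simp add: evalp_def)

lemma evalp_const [simp]: "evalp \<phi> s [:x:] = \<phi> x"
  by (simp add: evalp_def)

lemma evalp_lam1: "\<phi> 0 = 0 \<Longrightarrow> evalp \<phi> s (lam1 q) = s * evalp \<phi> s q"
  by (simp add: evalp_poly map_poly_pCons)

lemma evalp_map_poly:
  assumes "f 0 = 0" "\<phi> 0 = 0"
  shows "evalp \<phi> s (map_poly f q) = evalp (\<lambda>x. \<phi> (f x)) s q"
proof -
  have "evalp \<phi> s (map_poly f q) = (\<Sum>k\<le>degree q. s ^ k * \<phi> (coeff (map_poly f q) k))"
    by (rule evalp_bound[where n = "degree q"]) (simp_all add: assms map_poly_degree_leq)
  then show ?thesis
    by (simp add: evalp_def coeff_map_poly assms)
qed

lemma evalp_cong:
  "(\<And>k. \<phi> (coeff q k) = \<psi> (coeff q k)) \<Longrightarrow> evalp \<phi> s q = evalp \<psi> s q"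
  by (simp add: evalp_def)

lemma evalp_swap:
  "evalp (\<lambda>w. evalp (g w) s q) t p = evalp (\<lambda>z. evalp (\<lambda>w. g w z) t p) s q"
  unfolding evalp_def sum_distrib_left
  by (subst sum.swap) (simp add: mult_ac)

lemma evalp_functional_add: "evalp (\<lambda>x. \<phi> x + \<psi> x) s q = evalp \<phi> s q + evalp \<psi> s q"
  by (simp add: evalp_def distrib_left sum.distrib)

lemma evalp_functional_uminus: "evalp (\<lambda>x. - \<phi> x) s q = - evalp \<phi> s q"
  by (simp add: evalp_def sum_negf)

lemma evalp_functional_scale: "evalp (\<lambda>x. c * \<phi> x) s q = c * evalp \<phi> s q"
  by (simp add: evalp_def sum_distrib_left mult_ac)

lemma evalp_coefficients: "evalp (\<lambda>c. poly [:c:] z * K) s p = poly p s * K"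
  by (simp add: evalp_def poly_altdef sum_distrib_left mult_ac)

lemma evalp_functional_sum: "evalp (\<lambda>x. \<Sum>i\<in>A. \<phi> i x) s q = (\<Sum>i\<in>A. evalp (\<phi> i) s q)"
  unfolding evalp_def sum_distrib_left by (rule sum.swap)

lemma additive_evalp:
  fixes \<phi> :: "'v::ab_group_add \<Rightarrow> 'k::field_char_0"
  assumes "additive \<phi>"
  shows "additive (evalp \<phi> s)"
proof
  fix p q :: "'v poly"
  note [simp] = additive.zero[OF assms] additive.add[OF assms]
  let ?n = "max (degree p) (degree q)"
  show "evalp \<phi> s (p + q) = evalp \<phi> s p + evalp \<phi> s q"
    by (simp add: evalp_bound[of \<phi> _ ?n] degree_add_le distrib_left sum.distrib)
qed

text \<open>
  The one rule behind all substitutions: under a functional on the target for which \<open>A\<close> is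
  multiplication by \<open>s\<close>, substituting the operator \<open>A\<close> is evaluation at the number \<open>s\<close>.
\<close>
lemma additive_psubst:
  fixes L :: "'w::ab_group_add \<Rightarrow> 'k::field_char_0"
  assumes "additive L" and "\<And>w. L (A w) = s * L w"
  shows "L (psubst A h p) = evalp (\<lambda>x. L (h x)) s p"
proof -
  have "L ((A ^^ k) w) = s ^ k * L w" for k w
    by (induction k) (simp_all add: assms(2))
  then show ?thesis
    by (simp add: psubst_def evalp_def additive.sum[OF assms(1)])
qed

text \<open>
  Characteristic \<open>0\<close> enters here: a polynomial over an infinite field is determined by its values.
\<close>
lemma evalp_separating:
  assumes "\<phi> 0 = 0" "\<psi> 0 = 0" and "\<And>s. evalp \<phi> s p = evalp \<psi> s q"
  shows "\<phi> (coeff p n) = \<psi> (coeff q n)"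
proof -
  have "poly (map_poly \<phi> p) = poly (map_poly \<psi> q)"
    using assms by (simp add: evalp_poly fun_eq_iff)
  then have "map_poly \<phi> p = map_poly \<psi> q"
    by (simp only: poly_eq_poly_eq_iff)
  then show ?thesis
    by (metis assms(1,2) coeff_map_poly)
qed

lemma eigenfunctionalI:
  assumes "module act" "additive \<phi>"
    and "\<And>c x. \<phi> (act [:c:] x) = c * \<phi> x" and "\<And>x. \<phi> (kd_del act x) = \<gamma> * \<phi> x"
  shows "eigenfunctional act \<gamma> \<phi>"
proof -
  interpret module act by fact
  have "\<phi> (act p x) = poly p \<gamma> * \<phi> x" for p x
  proof (induction p)
    case 0
    then show ?case by (simp add: additive.zero[OF assms(2)])
  next
    case (pCons a p)
    have "act (pCons a p) x = act [:a:] x + kd_del act (act p x)"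
      by (simp add: scale_left_distrib[symmetric] del: scale_left_distrib)
    then show ?case
      by (simp add: additive.add[OF assms(2)] assms(3,4) pCons.IH algebra_simps
        del: scale_scale)
  qed
  then show ?thesis using assms(2) by (simp add: eigenfunctional_def)
qed

lemma eigenfunctional_additive: "eigenfunctional act \<gamma> \<phi> \<Longrightarrow> additive \<phi>"
  by (simp add: eigenfunctional_def)

lemma eigenfunctional_zero: "eigenfunctional act \<gamma> \<phi> \<Longrightarrow> \<phi> 0 = 0"
  by (simp add: eigenfunctional_def additive.zero)

lemma eigenfunctional_act: "eigenfunctional act \<gamma> \<phi> \<Longrightarrow> \<phi> (act p x) = poly p \<gamma> * \<phi> x"
  by (simp add: eigenfunctional_def)

lemma eigenfunctional_uminus:
  "eigenfunctional act \<gamma> \<phi> \<Longrightarrow> eigenfunctional act \<gamma> (\<lambda>x. - \<phi> x)"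
  by (auto simp: eigenfunctional_def additive_def)

lemma eigenfunctional_scale:
  "eigenfunctional act \<gamma> \<phi> \<Longrightarrow> eigenfunctional act \<gamma> (\<lambda>x. c * \<phi> x)"
  by (auto simp: eigenfunctional_def additive_def algebra_simps)

lemma eigenfunctional_evalp:
  "(\<And>z. eigenfunctional act \<gamma> (\<lambda>w. g w z)) \<Longrightarrow> eigenfunctional act \<gamma> (\<lambda>w. evalp (g w) s q)"
  by (auto simp: eigenfunctional_def additive_def evalp_def sum.distrib sum_distrib_left algebra_simps)

context
  fixes act :: "'k::field_char_0 poly \<Rightarrow> 'v::ab_group_add \<Rightarrow> 'v" and \<gamma> \<phi>
  assumes act: "module act" and eigen: "eigenfunctional act \<gamma> \<phi>"
begin

interpretation module act by (rule act)

lemmas evalp_arith = additive.zero[OF additive_evalp[OF eigenfunctional_additive[OF eigen]]]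
  additive.add[OF additive_evalp[OF eigenfunctional_additive[OF eigen]]]
  additive.minus[OF additive_evalp[OF eigenfunctional_additive[OF eigen]]]
  additive.diff[OF additive_evalp[OF eigenfunctional_additive[OF eigen]]]

lemma evalp_act: "evalp \<phi> s (map_poly (act p) q) = poly p \<gamma> * evalp \<phi> s q"
  by (simp add: evalp_map_poly eigenfunctional_zero[OF eigen] eigenfunctional_act[OF eigen]
      evalp_functional_scale)

lemma evalp_reflect: "evalp \<phi> s ((- lam1 - del1 act) q) = (- s - \<gamma>) * evalp \<phi> s q"
  by (simp add: evalp_arith evalp_lam1 eigenfunctional_zero[OF eigen] evalp_act algebra_simps)

text \<open>
  So (skew-)commutativity of a conformal product becomes a symmetry between the points \<open>s\<close> and \<open>-s-\<gamma>\<close>.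
\<close>
lemma evalp_psubst_reflect:
  "evalp \<phi> s (psubst (- lam1 - del1 act) emb1 q) = evalp \<phi> (- s - \<gamma>) q"
  by (subst additive_psubst[where s = "- s - \<gamma>"])
    (simp_all add: additive_evalp eigenfunctional_additive[OF eigen] evalp_reflect
      del: fun_Compl_def minus_apply)

end

section \<open>The conformal dual of a free module\<close>

lemma triv_act_const: "triv_act [:c:] = (\<lambda>x. c * x)"
  by (simp add: triv_act_def fun_eq_iff)

lemma map_poly_triv_act_const: "map_poly (triv_act [:c:]) q = smult c q"
  by (simp add: triv_act_const smult_conv_map_poly)

lemma del1_triv_act: "del1 triv_act q = 0"
  by (simp add: triv_act_def map_poly_eq_0_iff poly_eqI coeff_map_poly)

lemma additive_poly_at: "additive (\<lambda>q :: 'k::field_char_0 poly. poly q x)"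
  by (simp add: additive_def)

lemma poly_cdual_act: "poly (cdual_act p f u) x = poly p (- x) * poly (f u) x"
proof -
  have "poly (cdual_act p f u) x
      = evalp (\<lambda>c. poly (map_poly (triv_act [:c:]) (f u)) x) (- x) p"
    unfolding chom_act_def by (rule additive_psubst) (simp_all add: additive_poly_at)
  also have "\<dots> = evalp (\<lambda>c. c * poly (f u) x) (- x) p"
    by (simp add: map_poly_triv_act_const)
  also have "\<dots> = poly p (- x) * poly (f u) x"
    by (simp add: evalp_def poly_altdef sum_distrib_right mult_ac)
  finally show ?thesis .
qed

lemma poly_values_eqI:
  fixes p q :: "'k::field_char_0 poly"
  shows "(\<And>x. poly p x = poly q x) \<Longrightarrow> p = q"
  by (metis ext poly_eq_poly_eq_iff)

lemma poly_family_eqI: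
  fixes f g :: "'u \<Rightarrow> 'k::field_char_0 poly"
  shows "(\<And>u x. poly (f u) x = poly (g u) x) \<Longrightarrow> f = g"
  by (intro ext poly_values_eqI)

lemma module_cdual_act: "module (cdual_act :: 'k::field_char_0 poly \<Rightarrow> ('u \<Rightarrow> 'k poly) \<Rightarrow> _)"
  by standard (rule poly_family_eqI, simp add: poly_cdual_act algebra_simps)+

text \<open>
  The sign reflects \<open>(\<partial> f)\<^sub>x = - x f\<^sub>x\<close>.
\<close>
lemma eigenfunctional_point:
  "eigenfunctional cdual_act (- x) (\<lambda>f. poly (f u) x)"
  by (simp add: eigenfunctional_def additive_def poly_cdual_act)

lemma poly_of_functions_eqI:
  fixes q q' :: "('u \<Rightarrow> 'k::field_char_0 poly) poly"
  assumes "\<And>u x s. evalp (\<lambda>f. poly (f u) x) s q = evalp (\<lambda>f. poly (f u) x) s q'"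
  shows "q = q'"
  by (rule poly_eqI, rule poly_family_eqI)
    (rule evalp_separating[where p = q and q = q'], simp_all add: assms)

lemma poly_poly_of_functions_eqI:
  fixes q q' :: "('u \<Rightarrow> 'k::field_char_0 poly) poly poly"
  assumes "\<And>u x s t. evalp (evalp (\<lambda>f. poly (f u) x) s) t q = evalp (evalp (\<lambda>f. poly (f u) x) s) t q'"
  shows "q = q'"
  by (rule poly_eqI, rule poly_of_functions_eqI)
    (rule evalp_separating[where p = q and q = q'], simp_all add: assms)

text \<open>
  The trivial module has \<open>\<partial> = 0\<close>, so conformal linearity of \<open>f\<close> says that \<open>\<partial>\<close> becomes multiplication by
  the variable: the dual is \<open>Hom(P, k[\<partial>])\<close>, with a twisted action of \<open>\<partial>\<close>.
\<close>
lemma cdual_iff: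
  assumes "module act"
  shows "f \<in> cdual act UNIV \<longleftrightarrow> additive f \<and> (\<forall>p u. f (act p u) = p * f u)"
proof -
  interpret module act by fact
  have *: "f (act p u) = p * f u"
    if "additive f" "\<And>c u. f (act [:c:] u) = smult c (f u)" "\<And>u. f (kd_del act u) = pCons 0 (f u)"
    for p u
  proof (induction p)
    case 0
    then show ?case by (simp add: additive.zero[OF that(1)])
  next
    case (pCons a p)
    have "act (pCons a p) u = act [:a:] u + kd_del act (act p u)"
      by (simp add: scale_left_distrib[symmetric] del: scale_left_distrib)
    then show ?case
      by (simp add: additive.add[OF that(1)] that(2,3) pCons.IH del: scale_scale)
  qed
  show ?thesis
    unfolding cdual_def chom_def using *
    by (auto simp: map_poly_triv_act_const del1_triv_act additive_def simp del: scale_scale)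
qed

lemma eigenfunctional_cdual:
  assumes "module act" "f \<in> cdual act UNIV"
  shows "eigenfunctional act x (\<lambda>u. poly (f u) x)"
  using assms by (simp add: cdual_iff eigenfunctional_def additive_def)

locale free_kd_module = kd_module act UNIV
  for act :: "'k::field_char_0 poly \<Rightarrow> 'p::ab_group_add \<Rightarrow> 'p" +
  assumes free: "kd_free act"
begin

text \<open>
  Finitely many generators involve only finitely many members of a basis, and these already span.
\<close>
lemma finite_basis:
  obtains B where "finite B" "independent B" "span B = UNIV"
proof -
  obtain B where B: "independent B" "span B = UNIV"
    using free by (auto simp: kd_free_def)
  obtain G where G: "finite G" "span G = UNIV"
    using finitely_generated by blast
  have fin: "finite {b. representation B g b \<noteq> 0}" for g
    by (rule finite_representation)
  define B' where "B' = (\<Union>g\<in>G. {b. representation B g b \<noteq> 0})"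
  have "B' \<subseteq> B"
    by (auto simp: B'_def dest: representation_ne_zero)
  have "g \<in> span B'" if "g \<in> G" for g
  proof -
    have "(\<Sum>b | representation B g b \<noteq> 0. act (representation B g b) b) \<in> span B'"
      using that by (intro span_sum span_scale span_base) (auto simp: B'_def)
    then show ?thesis
      using sum_nonzero_representation_eq[of B g] B by simp
  qed
  then have "span G \<subseteq> span B'"
    by (intro span_minimal subspace_span) auto
  then have "span B' = UNIV" using G by auto
  moreover have "finite B'" using G fin by (simp add: B'_def)
  moreover have "independent B'"
    using B(1) \<open>B' \<subseteq> B\<close> by (meson dependent_mono)
  ultimately show ?thesis using that by blast
qed

definition basis :: "'p set" where
  "basis = (SOME B. finite B \<and> independent B \<and> span B = UNIV)"

lemma basis: "finite basis" "independent basis" "span basis = UNIV"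
proof -
  have "\<exists>B. finite B \<and> independent B \<and> span B = UNIV"
    by (rule finite_basis) blast
  from someI_ex[OF this]
  show "finite basis" "independent basis" "span basis = UNIV"
    by (simp_all add: basis_def)
qed

definition coord :: "'p \<Rightarrow> 'p \<Rightarrow> 'k poly" where
  "coord b x = representation basis x b"

lemma coord_in_cdual: "coord b \<in> cdual act UNIV"
  using basis
  by (simp add: cdual_iff[OF module_axioms] coord_def[abs_def] additive_def representation_add
      representation_scale)

lemma coord_basis: "b \<in> basis \<Longrightarrow> coord b' b = (if b = b' then 1 else 0)"
  using representation_basis[OF basis(2), of b] by (auto simp: coord_def)

lemma sum_coord: "(\<Sum>b\<in>basis. act (coord b x) b) = x"
  using basis unfolding coord_def by (intro sum_representation_eq) auto

lemma cdual_separates: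
  assumes "\<And>h \<gamma>. h \<in> cdual act UNIV \<Longrightarrow> poly (h x) \<gamma> = poly (h y) \<gamma>"
  shows "x = y"
proof -
  have "coord b x = coord b y" for b
    using assms[OF coord_in_cdual] by (rule poly_values_eqI)
  then have "(\<Sum>b\<in>basis. act (coord b x) b) = (\<Sum>b\<in>basis. act (coord b y) b)"
    by simp
  then show ?thesis by (simp only: sum_coord)
qed

lemma cdual_separates_polys:
  assumes "\<And>h \<gamma> s. h \<in> cdual act UNIV \<Longrightarrow>
    evalp (\<lambda>x. poly (h x) \<gamma>) s q = evalp (\<lambda>x. poly (h x) \<gamma>) s q'"
  shows "q = q'"
proof (rule poly_eqI, rule cdual_separates)
  fix n h \<gamma> assume h: "h \<in> cdual act UNIV"
  then have "h 0 = 0" by (simp add: cdual_iff[OF module_axioms] additive.zero)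
  then show "poly (h (coeff q n)) \<gamma> = poly (h (coeff q' n)) \<gamma>"
    using evalp_separating[of "\<lambda>x. poly (h x) \<gamma>" "\<lambda>x. poly (h x) \<gamma>" q q' n] assms[OF h]
    by simp
qed

lemma cdual_eq_on_basis:
  assumes "f \<in> cdual act UNIV" "g \<in> cdual act UNIV" "\<And>b. b \<in> basis \<Longrightarrow> f b = g b"
  shows "f = g"
proof
  fix x
  have expand: "f x = (\<Sum>b\<in>basis. coord b x * f b)" if "f \<in> cdual act UNIV" for f
  proof -
    have f: "additive f" "\<And>p u. f (act p u) = p * f u"
      using that by (simp_all add: cdual_iff[OF module_axioms])
    have "f x = f (\<Sum>b\<in>basis. act (coord b x) b)" by (simp only: sum_coord)
    then show ?thesis by (simp only: additive.sum[OF f(1)] f(2))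
  qed
  show "f x = g x"
    unfolding expand[OF assms(1)] expand[OF assms(2)] by (simp add: assms(3))
qed

text \<open>
  The coordinate functions generate the dual: \<open>f = \<Sum>\<^sub>b f(b)(-\<partial>) coord b\<close>, where the sign undoes that
  of the action on the dual.
\<close>
lemma kd_module_cdual: "kd_module cdual_act (cdual act UNIV)"
proof -
  interpret dual: module "cdual_act :: 'k poly \<Rightarrow> ('p \<Rightarrow> 'k poly) \<Rightarrow> _"
    by (rule module_cdual_act)
  have cdual_act_eq: "cdual_act p f u = pcompose p [:0, -1:] * f u"
    for p and f :: "'p \<Rightarrow> 'k poly" and u
    by (rule poly_values_eqI) (simp add: poly_cdual_act poly_pcompose)
  have sub: "dual.subspace (cdual act UNIV)"
    by (auto simp: dual.subspace_def cdual_iff[OF module_axioms] additive_def cdual_act_eq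
        algebra_simps)
  have "f \<in> dual.span (coord ` basis)" if f: "f \<in> cdual act UNIV" for f
  proof -
    let ?g = "\<Sum>b\<in>basis. cdual_act (pcompose (f b) [:0, -1:]) (coord b)"
    have "f = ?g"
    proof (rule cdual_eq_on_basis[OF f])
      show "?g \<in> cdual act UNIV"
        by (intro dual.subspace_sum[OF sub] dual.subspace_scale[OF sub] coord_in_cdual)
      fix b assume "b \<in> basis"
      have sumapp: "(\<Sum>b\<in>A. F b) u = (\<Sum>b\<in>A. F b u)" for A :: "'p set" and F :: "'p \<Rightarrow> 'p \<Rightarrow> 'k poly" and u
        by (induction A rule: infinite_finite_induct) auto
      have "?g b = (\<Sum>b'\<in>basis. if b = b' then f b' else 0)"
        using \<open>b \<in> basis\<close>
        by (auto simp: sumapp cdual_act_eq coord_basis pcompose_assoc[symmetric] pcompose_pCons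
            intro!: sum.cong)
      then show "f b = ?g b" using \<open>b \<in> basis\<close> basis(1) by simp
    qed
    then show ?thesis
      by (metis (no_types, lifting) dual.span_base dual.span_scale dual.span_sum imageI)
  qed
  moreover have "dual.span (coord ` basis) \<subseteq> cdual act UNIV"
    by (rule dual.span_minimal[OF _ sub]) (auto simp: coord_in_cdual)
  ultimately have "dual.span (coord ` basis) = cdual act UNIV" by blast
  then show ?thesis
    using sub basis(1) by unfold_locales blast+
qed

text \<open>
  \<open>P\<close> is spanned over \<open>k\<close> by the \<open>\<partial>\<^sup>i b\<close> with \<open>b\<close> in the basis. This form of induction suits
  statements that are stable under scalars but not under \<open>\<partial>\<close>.
\<close>
lemma kd_induct [case_names zero add scale basis]:
  assumes "Q 0" "\<And>x y. Q x \<Longrightarrow> Q y \<Longrightarrow> Q (x + y)" "\<And>c x. Q x \<Longrightarrow> Q (act [:c:] x)"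
    and "\<And>i b. b \<in> basis \<Longrightarrow> Q (act (monom 1 i) b)"
  shows "Q x"
proof -
  have Qsum: "Q (sum f A)" if "\<And>a. a \<in> A \<Longrightarrow> Q (f a)" for f :: "'a \<Rightarrow> 'p" and A
    using that by (induction A rule: infinite_finite_induct) (auto intro: assms)
  have "Q (act p b)" if "b \<in> basis" for p b
  proof -
    have "act p b = (\<Sum>i\<le>degree p. act [:coeff p i:] (act (monom 1 i) b))"
      by (simp add: scale_sum_left[symmetric] smult_monom poly_as_sum_of_monoms)
    also have "Q \<dots>" by (intro Qsum assms(3,4) that)
    finally show ?thesis .
  qed
  then have "Q (\<Sum>b\<in>basis. act (coord b x) b)" by (intro Qsum)
  then show ?thesis by (simp add: sum_coord)
qed

end

section \<open>Conformal products evaluated at scalars\<close>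

context
  fixes act :: "'k::field_char_0 poly \<Rightarrow> 'v::ab_group_add \<Rightarrow> 'v" and \<gamma> \<phi>
  assumes act: "module act" and eigen: "eigenfunctional act \<gamma> \<phi>"
begin

interpretation module act by (rule act)

lemma additive_evalp2: "additive (evalp (evalp \<phi> s) t)"
  by (intro additive_evalp eigenfunctional_additive[OF eigen])

lemma evalp2_scaling:
  "evalp (evalp \<phi> s) t (lam2 Q) = s * evalp (evalp \<phi> s) t Q"
  "evalp (evalp \<phi> s) t (mu2 Q) = t * evalp (evalp \<phi> s) t Q"
  "evalp (evalp \<phi> s) t (del2 act Q) = \<gamma> * evalp (evalp \<phi> s) t Q"
proof -
  have zero: "\<phi> 0 = 0" "evalp \<phi> s 0 = 0"
    by (simp_all add: eigenfunctional_zero[OF eigen])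
  show "evalp (evalp \<phi> s) t (lam2 Q) = s * evalp (evalp \<phi> s) t Q"
    by (simp add: evalp_map_poly zero evalp_lam1 evalp_functional_scale)
  show "evalp (evalp \<phi> s) t (mu2 Q) = t * evalp (evalp \<phi> s) t Q"
    by (simp add: evalp_lam1 zero)
  show "evalp (evalp \<phi> s) t (del2 act Q) = \<gamma> * evalp (evalp \<phi> s) t Q"
    by (simp add: evalp_map_poly zero evalp_act[OF act eigen] evalp_functional_scale)
qed

lemma evalp2_psubst:
  "evalp (evalp \<phi> s) t (psubst lam2 h p) = evalp (\<lambda>x. evalp (evalp \<phi> s) t (h x)) s p"
  "evalp (evalp \<phi> s) t (psubst mu2 h p) = evalp (\<lambda>x. evalp (evalp \<phi> s) t (h x)) t p"
  "evalp (evalp \<phi> s) t (psubst (lam2 + mu2) h p)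
    = evalp (\<lambda>x. evalp (evalp \<phi> s) t (h x)) (s + t) p"
  "evalp (evalp \<phi> s) t (psubst (- lam2 - del2 act) h p)
    = evalp (\<lambda>x. evalp (evalp \<phi> s) t (h x)) (- s - \<gamma>) p"
  "evalp (evalp \<phi> s) t (psubst (- lam2 - mu2 - del2 act) h p)
    = evalp (\<lambda>x. evalp (evalp \<phi> s) t (h x)) (- s - t - \<gamma>) p"
  by (rule additive_psubst[OF additive_evalp2],
      simp add: evalp2_scaling algebra_simps additive.add[OF additive_evalp2]
        additive.diff[OF additive_evalp2] additive.minus[OF additive_evalp2])+

end

text \<open>
  By sesquilinearity, fixing one argument of a product keeps eigenfunctionals. The weights that arise
  are what makes the axioms applicable to inner products.
\<close>
lemma eigenfunctional_right:
  assumes "conformal_product act mul" "eigenfunctional act \<gamma> \<phi>"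
  shows "eigenfunctional act (s + \<gamma>) (\<lambda>b. evalp \<phi> s (mul a b))"
proof -
  interpret conformal_product act mul by fact
  note ar = evalp_arith[OF module_axioms assms(2)] and ac = evalp_act[OF module_axioms assms(2)]
  show ?thesis
    by (rule eigenfunctionalI[OF module_axioms])
      (simp_all add: additive_def add_right scalar_right del_right ar ac
        evalp_lam1 eigenfunctional_zero[OF assms(2)] algebra_simps)
qed

lemma eigenfunctional_left:
  assumes "conformal_product act mul" "eigenfunctional act \<gamma> \<phi>"
  shows "eigenfunctional act (- s) (\<lambda>a. evalp \<phi> s (mul a b))"
proof -
  interpret conformal_product act mul by fact
  note ar = evalp_arith[OF module_axioms assms(2)] and ac = evalp_act[OF module_axioms assms(2)]
  show ?thesis
    by (rule eigenfunctionalI[OF module_axioms])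
      (simp_all add: additive_def add_left scalar_left del_left ar ac
        evalp_lam1 eigenfunctional_zero[OF assms(2)] algebra_simps)
qed

lemma (in lie_conformal_algebra) skew_eval:
  assumes "eigenfunctional act \<gamma> \<phi>"
  shows "evalp \<phi> s (br a b) = - evalp \<phi> (- s - \<gamma>) (br b a)"
  by (subst skew) (simp only: evalp_arith[OF module_axioms assms]
    evalp_psubst_reflect[OF module_axioms assms])

lemma (in lie_conformal_algebra) jacobi_eval:
  assumes "eigenfunctional act \<gamma> \<phi>"
  shows "evalp (\<lambda>y. evalp \<phi> s (br a y)) t (br b c)
      = evalp (\<lambda>x. evalp \<phi> (s + t) (br x c)) s (br a b)
        + evalp (\<lambda>y. evalp \<phi> t (br b y)) s (br a c)"
  using arg_cong[OF jacobi, of "evalp (evalp \<phi> s) t" a b c]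
  by (simp only: evalp2_psubst[OF module_axioms assms] evalp_const
      additive.add[OF additive_evalp2[OF module_axioms assms]])

lemma (in comm_assoc_conformal_algebra) comm_eval:
  assumes "eigenfunctional act \<gamma> \<phi>"
  shows "evalp \<phi> s (mul a b) = evalp \<phi> (- s - \<gamma>) (mul b a)"
  by (subst comm) (simp only: evalp_psubst_reflect[OF module_axioms assms])

lemma (in comm_assoc_conformal_algebra) assoc_eval:
  assumes "eigenfunctional act \<gamma> \<phi>"
  shows "evalp (\<lambda>x. evalp \<phi> (s + t) (mul x c)) s (mul a b)
      = evalp (\<lambda>y. evalp \<phi> s (mul a y)) t (mul b c)"
  using arg_cong[OF assoc, of "evalp (evalp \<phi> s) t" c a b]
  by (simp only: evalp2_psubst[OF module_axioms assms] evalp_const)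

text \<open>
  Both sides are \<open>(ab)c\<close>, once as \<open>a\<^sub>s b\<close> and once as \<open>b\<^sub>t a\<close>: the functional
  \<open>x \<mapsto> \<phi>(x\<^sub>s\<^sub>+\<^sub>t c)\<close> has weight \<open>-(s+t)\<close>, so commutativity exchanges \<open>s\<close> and \<open>t\<close>.
\<close>
lemma (in comm_assoc_conformal_algebra) left_comm_eval:
  assumes "eigenfunctional act \<gamma> \<phi>"
  shows "evalp (\<lambda>y. evalp \<phi> s (mul a y)) t (mul b c)
      = evalp (\<lambda>y. evalp \<phi> t (mul b y)) s (mul a c)"
proof -
  have "eigenfunctional act (- (s + t)) (\<lambda>x. evalp \<phi> (s + t) (mul x c))"
    by (rule eigenfunctional_left[OF conformal_product_axioms assms])
  from comm_eval[OF this, of s a b] show ?thesis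
    using assoc_eval[OF assms, of s t c a b] assoc_eval[OF assms, of t s c b a]
    by (simp add: add.commute)
qed

context poisson_conformal_algebra
begin

lemma leibniz_eval:
  assumes "eigenfunctional act \<gamma> \<phi>"
  shows "evalp (\<lambda>y. evalp \<phi> s (br a y)) t (mul b c)
      = evalp (\<lambda>x. evalp \<phi> (s + t) (mul x c)) s (br a b)
        + evalp (\<lambda>y. evalp \<phi> t (mul b y)) s (br a c)"
  using arg_cong[OF leibniz, of "evalp (evalp \<phi> s) t" a b c]
  by (simp only: evalp2_psubst[OF module_axioms assms] evalp_const
      additive.add[OF additive_evalp2[OF module_axioms assms]])

lemma product_br: "conformal_product act br"
  using lie_conformal_algebra_axioms by (rule lie_conformal_algebra.axioms)

lemma product_mul: "conformal_product act mul"
  using comm_assoc_conformal_algebra_axioms by (rule comm_assoc_conformal_algebra.axioms)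

lemma skew_nested_eval:
  assumes "eigenfunctional act \<gamma> \<phi>" "conformal_product act m"
  shows "evalp (\<lambda>x. evalp \<phi> (s + t) (m x c)) s (br a b)
      = - evalp (\<lambda>x. evalp \<phi> (t + s) (m x c)) t (br b a)"
  using skew_eval[OF eigenfunctional_left[OF assms(2,1), where s = "s + t" and b = c], of s a b]
  by (simp add: add.commute)

text \<open>
  This is the Leibniz rule for \<open>[c, ab]\<close>, with every bracket turned around. The value at which
  \<open>c\<close> acts from the left is the reflection of \<open>s + t\<close>.
\<close>
lemma right_leibniz_eval:
  assumes "eigenfunctional act \<gamma> \<phi>"
  shows "evalp (\<lambda>x. evalp \<phi> (s + t) (br x c)) s (mul a b)
      = evalp (\<lambda>y. evalp \<phi> s (mul a y)) t (br b c) + evalp (\<lambda>y. evalp \<phi> t (mul b y)) s (br a c)"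
proof -
  \<comment> \<open>the reflection of \<open>s + t\<close>\<close>
  let ?k = "- s - t - \<gamma>"
  have "evalp (\<lambda>x. evalp \<phi> (s + t) (br x c)) s (mul a b)
      = evalp (\<lambda>x. - evalp \<phi> ?k (br c x)) s (mul a b)"
    by (rule evalp_cong) (use skew_eval[OF assms, of "s + t"] in simp)
  also have "\<dots> = - evalp (\<lambda>x. evalp \<phi> ?k (br c x)) s (mul a b)"
    by (rule evalp_functional_uminus)
  also have "\<dots> = - (evalp (\<lambda>x. evalp \<phi> (?k + s) (mul x b)) ?k (br c a)
      + evalp (\<lambda>y. evalp \<phi> s (mul a y)) ?k (br c b))"
    by (simp only: leibniz_eval[OF assms])
  also have "evalp (\<lambda>y. evalp \<phi> s (mul a y)) ?k (br c b)
      = - evalp (\<lambda>y. evalp \<phi> s (mul a y)) t (br b c)"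
    using skew_eval[OF eigenfunctional_right[OF product_mul assms, where s = s and a = a], of ?k c b] by simp
  also have "evalp (\<lambda>x. evalp \<phi> (?k + s) (mul x b)) ?k (br c a)
      = - evalp (\<lambda>x. evalp \<phi> (?k + s) (mul x b)) s (br a c)"
    using skew_eval[OF eigenfunctional_left[OF product_mul assms, where s = "?k + s" and b = b], of ?k c a] by simp
  also have "evalp (\<lambda>x. evalp \<phi> (?k + s) (mul x b)) s (br a c)
      = evalp (\<lambda>y. evalp \<phi> t (mul b y)) s (br a c)"
    by (rule evalp_cong) (use comm_eval[OF assms, of "?k + s"] in simp)
  finally show ?thesis by simp
qed

text \<open>
  The form of the Leibniz rule that dualizes to the axiom of a representation for \<open>\<rho>(ab)\<close>. Passing
  from the right Leibniz rule, \<open>a[b,c] + b[a,c]\<close> becomes \<open>[a,bc] + [b,ac]\<close> because the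
  terms \<open>[a,b]c\<close> and \<open>[b,a]c\<close> cancel.
\<close>
lemma bracket_of_product_eval:
  assumes "eigenfunctional act \<gamma> \<phi>"
  shows "evalp (\<lambda>x. evalp \<phi> (s + t) (br x c)) s (mul a b)
      = evalp (\<lambda>y. evalp \<phi> s (br a y)) t (mul b c) + evalp (\<lambda>y. evalp \<phi> t (br b y)) s (mul a c)"
  using right_leibniz_eval[OF assms, of s t c a b] leibniz_eval[OF assms, of s a t b c]
    leibniz_eval[OF assms, of t b s a c] skew_nested_eval[OF assms product_mul, of s t c a b]
  by simp

end

section \<open>The coadjoint representation\<close>

text \<open>
  The evaluated form of \<open>(D(a)\<^sub>s f)\<^sub>x u = \<epsilon> f\<^sub>x\<^sub>-\<^sub>s(a\<^sub>s u)\<close>. The sign \<open>\<epsilon>\<close> allows one treatment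
  of the dual \<open>ad\<^sup>*\<close>, where it is \<open>-1\<close>, and of \<open>-L\<^sup>*\<close>, where it is \<open>1\<close>.
\<close>
definition contragredient ::
    "('k::field_char_0 poly \<Rightarrow> 'p::ab_group_add \<Rightarrow> 'p) \<Rightarrow> 'k \<Rightarrow> ('p \<Rightarrow> 'p \<Rightarrow> 'p poly) \<Rightarrow>
     ('p \<Rightarrow> ('p \<Rightarrow> 'k poly) \<Rightarrow> ('p \<Rightarrow> 'k poly) poly) \<Rightarrow> bool" where
  "contragredient act \<epsilon> m D \<longleftrightarrow> (\<forall>a. \<forall>f\<in>cdual act UNIV.
     (\<forall>n. coeff (D a f) n \<in> cdual act UNIV) \<and>
     (\<forall>u x s. evalp (\<lambda>F. poly (F u) x) s (D a f)
        = \<epsilon> * evalp (\<lambda>w. poly (f w) (x - s)) s (m a u)))"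

lemma evalp_contragredient:
  "contragredient act \<epsilon> m D \<Longrightarrow> f \<in> cdual act UNIV \<Longrightarrow>
    evalp (\<lambda>F. poly (F u) x) s (D a f) = \<epsilon> * evalp (\<lambda>w. poly (f w) (x - s)) s (m a u)"
  by (simp add: contragredient_def)

lemma coeff_contragredient:
  "contragredient act \<epsilon> m D \<Longrightarrow> f \<in> cdual act UNIV \<Longrightarrow> coeff (D a f) n \<in> cdual act UNIV"
  by (simp add: contragredient_def)

lemma contragredient_uminus:
  fixes act :: "'k::field_char_0 poly \<Rightarrow> 'p::ab_group_add \<Rightarrow> 'p"
  assumes "module act" "contragredient act \<epsilon> m D"
  shows "contragredient act (- \<epsilon>) m (\<lambda>a f. - D a f)"
proof -
  have "additive (evalp (\<lambda>F. poly (F u) x) s)" for u :: 'p and x s :: 'k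
    by (intro additive_evalp) (simp add: additive_def)
  moreover have "- f \<in> cdual act UNIV" if "f \<in> cdual act UNIV" for f
    using that by (auto simp: cdual_iff[OF assms(1)] additive_def)
  ultimately show ?thesis
    using assms(2) by (simp add: contragredient_def additive.minus)
qed

text \<open>
  Dualizing reverses the order of composition: \<open>D(a) D'(b) f\<close> is \<open>f\<close> after \<open>b\<close> after \<open>a\<close>.
\<close>
lemma contragredient_nested:
  assumes "contragredient act \<epsilon> m D" "contragredient act \<epsilon>' m' D'" "f \<in> cdual act UNIV"
  shows "evalp (\<lambda>F. evalp (\<lambda>G. poly (G u) x) s (D a F)) t (D' b f)
      = \<epsilon> * \<epsilon>' * evalp (\<lambda>z. evalp (\<lambda>w. poly (f w) (x - s - t)) t (m' b z)) s (m a u)"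
proof -
  have "evalp (\<lambda>F. evalp (\<lambda>G. poly (G u) x) s (D a F)) t (D' b f)
      = evalp (\<lambda>F. \<epsilon> * evalp (\<lambda>z. poly (F z) (x - s)) s (m a u)) t (D' b f)"
    by (intro evalp_cong evalp_contragredient[OF assms(1)] coeff_contragredient[OF assms(2,3)])
  also have "\<dots> = \<epsilon> * evalp (\<lambda>z. evalp (\<lambda>F. poly (F z) (x - s)) t (D' b f)) s (m a u)"
    by (simp only: evalp_functional_scale evalp_swap[of "\<lambda>F z. poly (F z) (x - s)"])
  also have "\<dots> = \<epsilon> * \<epsilon>' * evalp (\<lambda>z. evalp (\<lambda>w. poly (f w) (x - s - t)) t (m' b z)) s (m a u)"
    by (simp add: evalp_contragredient[OF assms(2,3)] evalp_functional_scale)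
  finally show ?thesis .
qed

lemma coeff_psubst_reflect:
  assumes "module act" "module.subspace act V" "\<And>n. coeff q n \<in> V"
  shows "coeff (psubst (- lam1 - del1 act) emb1 q) n \<in> V"
proof -
  interpret module act by fact
  note sub = subspace_0[OF assms(2)] subspace_neg[OF assms(2)] subspace_diff[OF assms(2)]
    subspace_scale[OF assms(2)]
  have step: "coeff ((- lam1 - del1 act) p) n \<in> V" if "\<And>n. coeff p n \<in> V" for p n
    using that sub by (auto simp: coeff_map_poly coeff_pCons split: nat.split)
  have "coeff (((- lam1 - del1 act) ^^ k) [:x:]) n \<in> V" if "x \<in> V" for k x n
    by (induction k arbitrary: n)
      (use that sub step in \<open>auto simp: coeff_pCons simp del: minus_apply split: nat.split\<close>)
  then show ?thesis
    unfolding psubst_def coeff_sum by (intro subspace_sum[OF assms(2)]) (simp add: assms(3))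
qed

text \<open>
  \<open>D a\<close> is controlled only on the dual, so it is first replaced by an expression that is an
  eigenfunctional on all functions and agrees with it there.
\<close>
lemma contragredient_psubst_reflect:
  assumes "module act" "module.subspace cdual_act (cdual act UNIV)"
    and "contragredient act \<epsilon> m D" "\<And>n. coeff q n \<in> cdual act UNIV"
  shows "evalp (\<lambda>F. evalp (\<lambda>G. poly (G u) x) s (D a F)) t
        (psubst (- lam1 - del1 cdual_act) emb1 q)
      = evalp (\<lambda>F. evalp (\<lambda>G. poly (G u) x) s (D a F)) (x - s - t) q"
proof -
  let ?psi = "\<lambda>F. \<epsilon> * evalp (\<lambda>z. poly (F z) (x - s)) s (m a u)"
  have psi: "eigenfunctional cdual_act (- (x - s)) ?psi"
    by (intro eigenfunctional_scale eigenfunctional_evalp eigenfunctional_point)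
  have "evalp (\<lambda>F. evalp (\<lambda>G. poly (G u) x) s (D a F)) t
        (psubst (- lam1 - del1 cdual_act) emb1 q)
      = evalp ?psi t (psubst (- lam1 - del1 cdual_act) emb1 q)"
    by (intro evalp_cong evalp_contragredient[OF assms(3)]
        coeff_psubst_reflect[OF module_cdual_act assms(2,4)])
  also have "\<dots> = evalp ?psi (- t - - (x - s)) q"
    by (rule evalp_psubst_reflect[OF module_cdual_act psi])
  also have "\<dots> = evalp (\<lambda>F. evalp (\<lambda>G. poly (G u) x) s (D a F)) (- t - - (x - s)) q"
    by (intro evalp_cong evalp_contragredient[OF assms(3), symmetric] assms(4))
  finally show ?thesis by (simp add: algebra_simps)
qed

lemma gc_hom_contragredient:
  fixes act :: "'k::field_char_0 poly \<Rightarrow> 'p::ab_group_add \<Rightarrow> 'p"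
  assumes "conformal_product act m" "contragredient act \<epsilon> m D"
  shows "gc_hom act cdual_act (cdual act UNIV) D"
proof -
  interpret conformal_product act m by fact
  let ?V = "cdual act UNIV"
  note pt = eigenfunctional_point
  note val = evalp_contragredient[OF assms(2)]
  note ar = evalp_arith[OF module_cdual_act pt] and ac = evalp_act[OF module_cdual_act pt]
  have V_add: "f + g \<in> ?V" if "f \<in> ?V" "g \<in> ?V" for f g
    using that by (auto simp: cdual_iff[OF module_axioms] additive_def algebra_simps)
  have V_act: "cdual_act p f \<in> ?V" if "f \<in> ?V" for p f
  proof -
    have "cdual_act p f (u + v) = cdual_act p f u + cdual_act p f v"
      "cdual_act p f (act q u) = q * cdual_act p f u" for u v q
      using that
      by (intro poly_values_eqI, simp add: poly_cdual_act cdual_iff[OF module_axioms]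
          additive.add algebra_simps)+
    then show ?thesis by (simp add: cdual_iff[OF module_axioms] additive_def)
  qed
  have act_eq: "D a (cdual_act p f) = q"
    if "f \<in> ?V" and "\<And>u x s. evalp (\<lambda>F. poly (F u) x) s q
      = poly p (s - x) * evalp (\<lambda>F. poly (F u) x) s (D a f)" for a p f q
    by (rule poly_of_functions_eqI)
      (simp add: that val V_act poly_cdual_act evalp_functional_scale)
  have "D a \<in> chom cdual_act ?V cdual_act ?V" for a
    unfolding chom_def
  proof (intro CollectI conjI allI ballI)
    fix f assume f: "f \<in> ?V"
    show "coeff (D a f) n \<in> ?V" for n
      by (rule coeff_contragredient[OF assms(2) f])
    show "D a (f + g) = D a f + D a g" if "g \<in> ?V" for g
      by (rule poly_of_functions_eqI)
        (simp add: ar val f that V_add evalp_functional_add algebra_simps)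
    show "D a (cdual_act [:c:] f) = map_poly (cdual_act [:c:]) (D a f)" for c
      by (rule act_eq[OF f]) (simp add: ac)
    show "D a (cdual_act [:0, 1:] f) = (del1 cdual_act + lam1) (D a f)"
      by (rule act_eq[OF f]) (simp add: ar ac evalp_lam1 algebra_simps)
  qed
  moreover have "D (a + b) f = D a f + D b f" if f: "f \<in> ?V" for a b f
    by (rule poly_of_functions_eqI)
      (simp add: ar val f algebra_simps additive.add[OF eigenfunctional_additive[OF
        eigenfunctional_left[OF assms(1) eigenfunctional_cdual[OF module_axioms f]]]])
  moreover have "D (act p a) f = chom_act cdual_act p (D a) f" if f: "f \<in> ?V" for p a f
  proof (rule poly_of_functions_eqI)
    fix u :: 'p and x s :: 'k
    have add: "additive (evalp (\<lambda>F. poly (F u) x) s)"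
      by (rule additive_evalp[OF eigenfunctional_additive[OF pt]])
    have "evalp (\<lambda>F. poly (F u) x) s (chom_act cdual_act p (D a) f)
        = evalp (\<lambda>c. evalp (\<lambda>F. poly (F u) x) s (map_poly (cdual_act [:c:]) (D a f))) (- s) p"
      unfolding chom_act_def
      by (rule additive_psubst[OF add]) (simp add: ar evalp_lam1)
    also have "\<dots> = poly p (- s) * evalp (\<lambda>F. poly (F u) x) s (D a f)"
      by (simp only: ac evalp_coefficients)
    finally show "evalp (\<lambda>F. poly (F u) x) s (D (act p a) f)
        = evalp (\<lambda>F. poly (F u) x) s (chom_act cdual_act p (D a) f)"
      by (simp add: val f eigenfunctional_act[OF
        eigenfunctional_left[OF assms(1) eigenfunctional_cdual[OF module_axioms f]]])
  qed
  ultimately show ?thesis by (simp add: gc_hom_def)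
qed

lemma poly_const_poly: "poly (poly Q [:t:]) s = evalp (\<lambda>q. poly q s) t Q"
  by (induction Q) (simp_all add: evalp_poly map_poly_pCons)

text \<open>
  \<open>Q\<close> is a polynomial in \<open>\<mu>\<close> over \<open>k[\<lambda>]\<close>; setting \<open>\<mu> = t\<close> leaves a polynomial in \<open>\<lambda>\<close>, which is how single
  coefficients of \<open>\<lambda>\<^sup>n\<close> are reached.
\<close>
lemma coeff_poly_const: "coeff (poly Q [:t:]) n = poly (map_poly (\<lambda>q. coeff q n) Q) t"
  by (induction Q) (simp_all add: map_poly_pCons)

lemma evalp_gc_dual_value:
  fixes m :: "'p \<Rightarrow> 'p \<Rightarrow> 'p::ab_group_add poly"
  shows "evalp (\<lambda>q. poly q s) t (gc_dual_value m a f u)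
    = - evalp (\<lambda>w. poly (f w) (t - s)) s (m a u)"
proof -
  let ?L = "evalp (\<lambda>q. poly q s) t"
  have L: "additive ?L" by (intro additive_evalp additive_poly_at)
  have scal: "?L (lam2 Q) = s * ?L Q" "?L (mu2 Q) = t * ?L Q" for Q
    by (simp_all add: evalp_map_poly evalp_functional_scale evalp_lam1)
  have "?L (psubst (mu2 - lam2) emb2 p) = poly p (t - s)" for p
  proof -
    have "?L (psubst (mu2 - lam2) emb2 p) = evalp (\<lambda>c. ?L (emb2 c)) (t - s) p"
      by (rule additive_psubst[OF L]) (simp add: additive.diff[OF L] scal algebra_simps)
    then show ?thesis by (simp add: evalp_def[of _ _ p] poly_altdef mult.commute)
  qed
  then show ?thesis
    by (simp add: gc_dual_value_def additive.minus[OF L] additive_psubst[OF L, OF scal(1)])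
qed

text \<open>
  The point is that the family of coefficients of \<open>\<lambda>\<^sup>n\<close> vanishes for large \<open>n\<close>, uniformly in \<open>u\<close>.
  Each coefficient is itself in the dual, because the evaluated value at \<open>\<mu> = t\<close> is an
  eigenfunctional of weight \<open>s + (t - s) = t\<close> in \<open>u\<close>; hence it is zero as soon as it vanishes on the
  finite basis.
\<close>
lemma contragredient_gc_dual:
  fixes act :: "'k::field_char_0 poly \<Rightarrow> 'p::ab_group_add \<Rightarrow> 'p"
  assumes "free_kd_module act" "conformal_product act m"
  shows "contragredient act (- 1) m (gc_dual m)"
proof -
  interpret free_kd_module act by fact
  have "(\<forall>n. coeff (gc_dual m a f) n \<in> cdual act UNIV) \<and>
     (\<forall>u x s. evalp (\<lambda>F. poly (F u) x) s (gc_dual m a f)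
        = - evalp (\<lambda>w. poly (f w) (x - s)) s (m a u))"
    if f: "f \<in> cdual act UNIV" for a f
  proof -
    let ?G = "gc_dual_value m a f"
    \<comment> \<open>the coefficient of \<open>\<lambda>\<^sup>n\<close>, a polynomial in \<open>\<mu>\<close>\<close>
    define c where "c n u = map_poly (\<lambda>q. coeff q n) (?G u)" for n u
    have G: "poly (poly (?G u) [:t:]) s = - evalp (\<lambda>w. poly (f w) (t - s)) s (m a u)" for u s t
      by (simp add: poly_const_poly evalp_gc_dual_value)
    have eigen: "eigenfunctional act t (\<lambda>u. poly (poly (?G u) [:t:]) s)" for s t
      unfolding G using eigenfunctional_uminus[OF eigenfunctional_right[OF assms(2)
        eigenfunctional_cdual[OF module_axioms f, of "t - s"], where s = s and a = a]] by simp
    have "poly (?G (u + v)) [:t:] = poly (?G u) [:t:] + poly (?G v) [:t:]"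
      "poly (?G (act p u)) [:t:] = smult (poly p t) (poly (?G u) [:t:])" for u v p t
      using eigen by (intro poly_values_eqI, simp add: eigenfunctional_def additive_def)+
    then have "poly (c n (u + v)) t = poly (c n u + c n v) t"
      "poly (c n (act p u)) t = poly (p * c n u) t" for n u v p t
      unfolding c_def by (simp_all add: coeff_poly_const[symmetric])
    then have "c n (u + v) = c n u + c n v" "c n (act p u) = p * c n u" for n u v p
      by (intro poly_values_eqI; blast)+
    then have c: "c n \<in> cdual act UNIV" for n
      by (simp add: cdual_iff[OF module_axioms] additive_def)
    have zero: "(0 :: 'p \<Rightarrow> 'k poly) \<in> cdual act UNIV"
      by (simp add: cdual_iff[OF module_axioms] additive_def)
    have fin: "finite {n. c n b \<noteq> 0}" for b
    proof (rule finite_subset)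
      show "{n. c n b \<noteq> 0} \<subseteq> (\<Union>k\<le>degree (?G b). {..degree (coeff (?G b) k)})"
      proof
        fix n assume "n \<in> {n. c n b \<noteq> 0}"
        then obtain k where "coeff (coeff (?G b) k) n \<noteq> 0"
          by (auto simp: c_def poly_eq_iff coeff_map_poly)
        moreover from this have "coeff (?G b) k \<noteq> 0" by auto
        ultimately show "n \<in> (\<Union>k\<le>degree (?G b). {..degree (coeff (?G b) k)})"
          by (intro UN_I[of k]) (auto intro: le_degree)
      qed
    qed simp
    obtain N where N: "\<And>b n. b \<in> basis \<Longrightarrow> c n b \<noteq> 0 \<Longrightarrow> n \<le> N"
    proof -
      have "finite (\<Union>b\<in>basis. {n. c n b \<noteq> 0})" using basis(1) fin by blast
      then obtain N where "\<forall>n\<in>(\<Union>b\<in>basis. {n. c n b \<noteq> 0}). n \<le> N"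
        by (meson finite_nat_set_iff_bounded_le)
      then show ?thesis using that by blast
    qed
    have "c n = 0" if "n > N" for n
      by (rule cdual_eq_on_basis[OF c zero]) (use N that in force)
    then have coeff: "coeff (gc_dual m a f) = c"
      unfolding gc_dual_def c_def[abs_def] by (intro coeff_Abs_poly) auto
    have "map_poly (\<lambda>F. poly (F u) x) (gc_dual m a f) = poly (?G u) [:x:]" for u x
      by (rule poly_eqI) (simp add: coeff_map_poly coeff coeff_poly_const c_def)
    then have "evalp (\<lambda>F. poly (F u) x) s (gc_dual m a f)
        = - evalp (\<lambda>w. poly (f w) (x - s)) s (m a u)" for u x s
      by (simp add: evalp_poly[of "\<lambda>F. poly (F u) x"] G)
    with c coeff show ?thesis by simp
  qed
  then show ?thesis by (simp add: contragredient_def)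
qed

locale free_poisson = poisson_conformal_algebra act br mul + free_kd_module act
  for act :: "'k::field_char_0 poly \<Rightarrow> 'p::ab_group_add \<Rightarrow> 'p" and br mul
begin

abbreviation "coad \<equiv> gc_dual br"
abbreviation "dual_mul \<equiv> (\<lambda>a f. - gc_dual mul a f)"

lemma coad: "contragredient act (- 1) br coad"
  by (rule contragredient_gc_dual[OF free_kd_module_axioms product_br])

lemma dual_mul: "contragredient act 1 mul dual_mul"
  using contragredient_uminus[OF module_axioms
    contragredient_gc_dual[OF free_kd_module_axioms product_mul]] by simp

text \<open>
  Each axiom, evaluated at \<open>s\<close> and \<open>t\<close> under \<open>F \<mapsto> F\<^sub>x(u)\<close>, is a law of \<open>P\<close> evaluated under
  \<open>v\<^sub>x\<^sub>-\<^sub>s\<^sub>-\<^sub>t\<close>. In the axiom for \<open>\<rho>(ab)\<close>, whose substitutions contain \<open>\<partial>\<close>, the functional is \<open>v\<^sub>s\<close>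
  and the products are taken at \<open>t\<close> and \<open>x - s - t\<close>.
\<close>
theorem coadjoint_representation:
  "poisson_representation act br mul cdual_act (cdual act UNIV) coad dual_mul"
proof -
  interpret V: kd_module "cdual_act :: 'k poly \<Rightarrow> ('p \<Rightarrow> 'k poly) \<Rightarrow> _" "cdual act UNIV"
    by (rule kd_module_cdual)
  note ev2 = evalp2_psubst[OF module_cdual_act eigenfunctional_point] evalp_const
    additive.add[OF additive_evalp2[OF module_cdual_act eigenfunctional_point]]
    additive.diff[OF additive_evalp2[OF module_cdual_act eigenfunctional_point]]
  note nested = contragredient_nested[OF coad coad] contragredient_nested[OF coad dual_mul]
     contragredient_nested[OF dual_mul coad] contragredient_nested[OF dual_mul dual_mul]
  note refl = contragredient_psubst_reflect[OF module_axioms V.submodule]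
  note val = evalp_contragredient[OF coad] evalp_contragredient[OF dual_mul]
  show ?thesis
  proof unfold_locales
    show "gc_hom act cdual_act (cdual act UNIV) coad"
      by (rule gc_hom_contragredient[OF product_br coad])
    show "gc_hom act cdual_act (cdual act UNIV) dual_mul"
      by (rule gc_hom_contragredient[OF product_mul dual_mul])
  next
    fix v a b assume v: "v \<in> cdual act UNIV"
    note eig = eigenfunctional_cdual[OF module_axioms v]
    show "psubst lam2 (\<lambda>x. psubst (lam2 + mu2) emb2 (coad x v)) (br a b)
        = psubst mu2 (\<lambda>w. psubst lam2 emb2 (coad a w)) (coad b v)
          - psubst lam2 (\<lambda>w. psubst mu2 emb2 (coad b w)) (coad a v)"
    proof (rule poly_poly_of_functions_eqI, goal_cases)
      case (1 u x s t)
      from jacobi_eval[OF eig[of "x - (s + t)"], of s a t b u] show ?case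
        by (simp add: ev2 nested[OF v] val[OF v] evalp_functional_uminus diff_diff_eq
            add.commute[of t s])
    qed
    show "psubst lam2 (\<lambda>x. psubst (lam2 + mu2) emb2 (dual_mul x v)) (mul a b)
        = psubst mu2 (\<lambda>w. psubst lam2 emb2 (dual_mul a w)) (dual_mul b v)"
    proof (rule poly_poly_of_functions_eqI, goal_cases)
      case (1 u x s t)
      from left_comm_eval[OF eig[of "x - (s + t)"], of s a t b u]
        assoc_eval[OF eig[of "x - (s + t)"], of s t u a b] show ?case
        by (simp add: ev2 nested[OF v] val[OF v] diff_diff_eq)
    qed
    show "psubst mu2 (\<lambda>w. psubst lam2 emb2 (coad a w)) (dual_mul b v)
        = psubst lam2 (\<lambda>x. psubst (lam2 + mu2) emb2 (dual_mul x v)) (br a b)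
          + psubst lam2 (\<lambda>w. psubst mu2 emb2 (dual_mul b w)) (coad a v)"
    proof (rule poly_poly_of_functions_eqI, goal_cases)
      case (1 u x s t)
      from leibniz_eval[OF eig[of "x - (s + t)"], of s a t b u] show ?case
        by (simp add: ev2 nested[OF v] val[OF v] evalp_functional_uminus diff_diff_eq
            add.commute[of t s])
    qed
    show "psubst mu2 (\<lambda>x. psubst (- lam2 - del2 cdual_act) emb2 (coad x v)) (mul a b)
        = psubst lam2 (\<lambda>w. psubst (- lam2 - mu2 - del2 cdual_act) emb2 (dual_mul b w))
            (psubst (- lam1 - del1 cdual_act) emb1 (coad a v))
          + psubst lam2 (\<lambda>w. psubst mu2 emb2 (dual_mul a w))
            (psubst (- lam1 - del1 cdual_act) emb1 (coad b v))"
    proof (rule poly_poly_of_functions_eqI)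
      fix u :: 'p and x s t :: 'k
      let ?\<sigma> = "x - s - t"
      from eig[of s] have "evalp (\<lambda>z. evalp (\<lambda>w. poly (v w) s) (t + ?\<sigma>) (br z u)) t (mul a b)
        = evalp (\<lambda>z. evalp (\<lambda>w. poly (v w) s) t (br a z)) ?\<sigma> (mul b u)
         + evalp (\<lambda>z. evalp (\<lambda>w. poly (v w) s) ?\<sigma> (br b z)) t (mul a u)"
        by (rule bracket_of_product_eval)
      then show "evalp (evalp (\<lambda>f. poly (f u) x) s) t
          (psubst mu2 (\<lambda>x. psubst (- lam2 - del2 cdual_act) emb2 (coad x v)) (mul a b))
        = evalp (evalp (\<lambda>f. poly (f u) x) s) t
         (psubst lam2 (\<lambda>w. psubst (- lam2 - mu2 - del2 cdual_act) emb2 (dual_mul b w))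
            (psubst (- lam1 - del1 cdual_act) emb1 (coad a v))
          + psubst lam2 (\<lambda>w. psubst mu2 emb2 (dual_mul a w))
            (psubst (- lam1 - del1 cdual_act) emb1 (coad b v)))"
        by (simp add: ev2 refl[OF dual_mul] coeff_contragredient[OF coad v] nested[OF v] val[OF v]
            evalp_functional_uminus) (simp add: algebra_simps)
    qed
  qed
qed

end

section \<open>Pairing with tensors\<close>

definition pair :: "('b \<Rightarrow> 'k) \<Rightarrow> ('b \<Rightarrow>\<^sub>0 'k::field_char_0) \<Rightarrow> 'k" where
  "pair \<phi> t = (\<Sum>b\<in>Poly_Mapping.keys t. Poly_Mapping.lookup t b * \<phi> b)"

lemma additive_pair: "additive (pair \<phi>)"
  by standard (simp add: pair_def, rule setsum_keys_plus_distrib, simp_all add: algebra_simps)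

lemma pair_single [simp]: "pair \<phi> (Poly_Mapping.single b c) = c * \<phi> b"
  by (simp add: pair_def)

lemma lookup_fscale [simp]: "Poly_Mapping.lookup (fscale c t) b = c * Poly_Mapping.lookup t b"
  by (simp add: fscale_def Poly_Mapping.map.rep_eq when_def)

lemma keys_fscale: "Poly_Mapping.keys (fscale c t) \<subseteq> Poly_Mapping.keys t"
  by (auto simp: in_keys_iff)

lemma fscale_single [simp]: "fscale c (Poly_Mapping.single b d) = Poly_Mapping.single b (c * d)"
  by (rule poly_mapping_eqI) (simp add: lookup_single when_def)

interpretation formal: module "fscale :: 'k::field_char_0 \<Rightarrow> ('b \<Rightarrow>\<^sub>0 'k) \<Rightarrow> _"
  by standard (rule poly_mapping_eqI, simp add: lookup_add algebra_simps)+

lemma pair_fscale [simp]: "pair \<phi> (fscale c t) = c * pair \<phi> t"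
proof -
  have "pair \<phi> (fscale c t)
      = (\<Sum>b\<in>Poly_Mapping.keys t. Poly_Mapping.lookup (fscale c t) b * \<phi> b)"
    unfolding pair_def
    by (rule sum.mono_neutral_left) (use keys_fscale[of c t] in \<open>auto simp: in_keys_iff\<close>)
  then show ?thesis by (simp add: pair_def sum_distrib_left mult_ac)
qed

lemma formal_sum: "t = (\<Sum>b\<in>Poly_Mapping.keys t.
    fscale (Poly_Mapping.lookup t b) (Poly_Mapping.single b 1))"
proof (rule poly_mapping_eqI)
  fix x
  show "Poly_Mapping.lookup t x = Poly_Mapping.lookup (\<Sum>b\<in>Poly_Mapping.keys t.
    fscale (Poly_Mapping.lookup t b) (Poly_Mapping.single b 1)) x"
    by (simp add: lookup_sum lookup_single when_def sum.delta' in_keys_iff)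
qed

lemma additive_flift: "additive (flift g)"
  by standard (simp add: flift_def, rule setsum_keys_plus_distrib, simp_all add: single_add)

lemma flift_single [simp]: "flift g (Poly_Mapping.single b c) = Poly_Mapping.single (g b) c"
  by (simp add: flift_def)

lemma flift_fscale: "flift g (fscale c t) = fscale c (flift g t)"
proof -
  have "flift g (fscale c t) = (\<Sum>b\<in>Poly_Mapping.keys t.
      Poly_Mapping.single (g b) (Poly_Mapping.lookup (fscale c t) b))"
    unfolding flift_def
    by (rule sum.mono_neutral_left) (use keys_fscale[of c t] in \<open>auto simp: in_keys_iff\<close>)
  then show ?thesis by (simp add: flift_def formal.scale_sum_right)
qed

lemma pair_flift: "pair \<phi> (flift g t) = pair (\<lambda>b. \<phi> (g b)) t"
  by (simp add: flift_def additive.sum[OF additive_pair]) (simp add: pair_def)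

lemma pair_span_zero:
  assumes "t \<in> module.span fscale S" "\<And>s. s \<in> S \<Longrightarrow> pair \<phi> s = 0"
  shows "pair \<phi> t = 0"
proof -
  have "formal.subspace {t. pair \<phi> t = 0}"
    by (simp add: formal.subspace_def additive.zero[OF additive_pair]
        additive.add[OF additive_pair])
  from formal.span_minimal[OF _ this, of S] show ?thesis using assms by auto
qed

definition pair2 where "pair2 F G = pair (\<lambda>(a, b). F a * G b)"
definition pair3 where "pair3 F G H = pair (\<lambda>(a, b, c). F a * G b * H c)"

lemma additive_pair3: "additive (pair3 F G H)"
  unfolding pair3_def by (rule additive_pair)

lemma pair3_tens3: "pair3 F G H (tens3 a b c) = F a * G b * H c"
  by (simp add: pair3_def tens3_def)

lemma pair2_rel:
  assumes "eigenfunctional act \<alpha> F" "eigenfunctional act \<beta> G" "t \<in> tens2_rel act"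
  shows "pair2 F G t = 0"
  unfolding pair2_def
  by (rule pair_span_zero[OF assms(3)[unfolded tens2_rel_def]])
    (auto simp: tens2_def additive.diff[OF additive_pair] eigenfunctional_act[OF assms(1)]
      eigenfunctional_act[OF assms(2)] additive.add[OF eigenfunctional_additive[OF assms(1)]]
      additive.add[OF eigenfunctional_additive[OF assms(2)]] distrib_left distrib_right mult_ac)

text \<open>
  Skew-symmetry holds only modulo the multilinearity relations, which is why it is used through a
  pair of linear functionals.
\<close>
lemma skew_contraction:
  assumes "skew_symmetric_tensor act I r l" "eigenfunctional act \<alpha> F" "eigenfunctional act \<beta> G"
  shows "(\<Sum>i\<in>I. F (r i) * G (l i)) = - (\<Sum>i\<in>I. F (l i) * G (r i))"
proof -
  have "pair2 F G (flift prod.swap (\<Sum>i\<in>I. tens2 (r i) (l i)) - - (\<Sum>i\<in>I. tens2 (r i) (l i))) = 0"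
    using assms by (intro pair2_rel) (auto simp: skew_symmetric_tensor_def tens2_eq_def)
  then show ?thesis
    by (simp add: pair2_def additive.add[OF additive_pair] additive.sum[OF additive_pair]
        additive.sum[OF additive_flift] tens2_def add_eq_0_iff)
qed

context
  fixes act :: "'k::field_char_0 poly \<Rightarrow> 'p::ab_group_add \<Rightarrow> 'p" and F G H \<alpha> \<beta> \<gamma>
  assumes F: "eigenfunctional act \<alpha> F" and G: "eigenfunctional act \<beta> G"
    and H: "eigenfunctional act \<gamma> H"
begin

lemma pair3_del:
  "pair3 F G H (dII act t) = \<alpha> * pair3 F G H t"
  "pair3 F G H (IdI act t) = \<beta> * pair3 F G H t"
  "pair3 F G H (IId act t) = \<gamma> * pair3 F G H t"
  unfolding pair3_def dII_def IdI_def IId_def pair_flift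
  by (simp_all add: pair_def sum_distrib_left
      eigenfunctional_act[OF F] eigenfunctional_act[OF G] eigenfunctional_act[OF H]
      case_prod_beta mult_ac)

lemma pair3_rel:
  assumes "t \<in> tens3_rel act"
  shows "pair3 F G H t = 0"
  unfolding pair3_def
  by (rule pair_span_zero[OF assms[unfolded tens3_rel_def]])
    (auto simp: tens3_def additive.diff[OF additive_pair] eigenfunctional_act[OF F]
      eigenfunctional_act[OF G] eigenfunctional_act[OF H]
      additive.add[OF eigenfunctional_additive[OF F]]
      additive.add[OF eigenfunctional_additive[OF G]]
      additive.add[OF eigenfunctional_additive[OF H]] distrib_left distrib_right mult_ac)

lemma pair3_in_del_tens3:
  assumes "\<alpha> + \<beta> + \<gamma> = 0" "in_del_tens3 act s"
  shows "pair3 F G H s = 0"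
proof -
  obtain t where t: "s - (dII act t + IdI act t + IId act t) \<in> tens3_rel act"
    using assms(2) by (auto simp: in_del_tens3_def tens3_eq_def)
  have "pair3 F G H s = (\<alpha> + \<beta> + \<gamma>) * pair3 F G H t"
    using pair3_rel[OF t]
    by (simp add: additive.diff[OF additive_pair3] additive.add[OF additive_pair3] pair3_del
        algebra_simps)
  then show ?thesis using assms(1) by simp
qed

lemma pair3_psubst:
  "pair3 F G H (psubst (dII act) h p) = evalp (\<lambda>x. pair3 F G H (h x)) \<alpha> p"
  "pair3 F G H (psubst (IdI act) h p) = evalp (\<lambda>x. pair3 F G H (h x)) \<beta> p"
  "pair3 F G H (psubst (IId act) h p) = evalp (\<lambda>x. pair3 F G H (h x)) \<gamma> p"
  "pair3 F G H (psubst (- (dII act + IdI act)) h p)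
    = evalp (\<lambda>x. pair3 F G H (h x)) (- \<alpha> - \<beta>) p"
  by (rule additive_psubst[OF additive_pair3],
      simp add: pair3_del additive.add[OF additive_pair3] additive.minus[OF additive_pair3]
        additive.diff[OF additive_pair3]
        algebra_simps)+

lemma pair3_yb_bracket:
  "pair3 F G H (yb_bracket act br I r l) = (\<Sum>i\<in>I. \<Sum>j\<in>I.
      evalp F \<beta> (br (r i) (r j)) * G (l i) * H (l j)
    - F (r i) * evalp G \<gamma> (br (r j) (l i)) * H (l j)
    - F (r i) * G (r j) * evalp H \<beta> (br (l j) (l i)))"
proof -
  have "evalp (\<lambda>x. F x * c * d) s q = evalp F s q * c * d"
    "evalp (\<lambda>x. c * G x * d) s q = c * evalp G s q * d"
    "evalp (\<lambda>x. c * d * H x) s q = c * d * evalp H s q" for c d s q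
    by (simp_all add: evalp_def sum_distrib_left mult_ac)
  then show ?thesis
    by (simp add: yb_bracket_def additive.sum[OF additive_pair3] additive.diff[OF additive_pair3]
        pair3_psubst pair3_tens3)
qed

lemma pair3_yb_prod:
  "pair3 F G H (yb_prod act mul I r l) = (\<Sum>i\<in>I. \<Sum>j\<in>I.
      F (r i) * G (r j) * evalp H \<alpha> (mul (l i) (l j))
    - F (r i) * evalp G (- \<alpha> - \<beta>) (mul (r j) (l i)) * H (l j)
    + evalp F \<beta> (mul (r i) (r j)) * G (l i) * H (l j))"
proof -
  have "evalp (\<lambda>x. F x * c * d) s q = evalp F s q * c * d"
    "evalp (\<lambda>x. c * G x * d) s q = c * evalp G s q * d"
    "evalp (\<lambda>x. c * d * H x) s q = c * d * evalp H s q" for c d s q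
    by (simp_all add: evalp_def sum_distrib_left mult_ac)
  then show ?thesis
    by (simp add: yb_prod_def additive.sum[OF additive_pair3] additive.diff[OF additive_pair3]
        additive.add[OF additive_pair3] pair3_psubst pair3_tens3 del: minus_add_distrib)
qed

end

text \<open>
  A polynomial function in two variables over an infinite field determines its coefficients.
\<close>
lemma bivariate_coeffs_zero:
  fixes w :: "nat \<times> nat \<Rightarrow> 'k::field_char_0"
  assumes "finite J" "\<And>x y. (\<Sum>(i, j)\<in>J. w (i, j) * (x ^ i * y ^ j)) = 0" "ij \<in> J"
  shows "w ij = 0"
proof -
  define Q where "Q = (\<Sum>(i, j)\<in>J. monom (monom (w (i, j)) j) i)"
  have Q: "poly (poly Q [:x:]) y = 0" for x y
    using assms(2)[of x y]
    by (simp add: Q_def poly_sum case_prod_beta poly_monom poly_const_pow mult_ac)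
  then have "poly Q [:x:] = 0" for x
    by (intro poly_values_eqI) simp
  then have "poly (map_poly (\<lambda>q. coeff q n) Q) x = poly 0 x" for n x
    by (simp add: coeff_poly_const[symmetric])
  then have "map_poly (\<lambda>q. coeff q n) Q = 0" for n
    by (rule poly_values_eqI)
  then have "coeff (map_poly (\<lambda>q. coeff q n) Q) m = 0" for m n
    by simp
  then have zero: "coeff (coeff Q m) n = 0" for m n
    by (simp add: coeff_map_poly)
  have "coeff (coeff Q (fst ij)) (snd ij) = (\<Sum>b\<in>J. if b = ij then w b else 0)"
    unfolding Q_def coeff_sum by (rule sum.cong) (auto simp: prod_eq_iff)
  then show ?thesis using zero assms(1,3) by simp
qed

context free_kd_module
begin

lemma tens3_rel_subspace: "module.subspace fscale (tens3_rel act)"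
  unfolding tens3_rel_def by (rule formal.subspace_span)

lemma subspace_in_del_tens3: "module.subspace fscale {s. in_del_tens3 act s}"
proof -
  let ?D = "dII act + IdI act + IId act"
  have D: "?D (s + t) = ?D s + ?D t" "?D (fscale c t) = fscale c (?D t)" "?D 0 = 0" for s t c
    by (simp_all add: dII_def IdI_def IId_def additive.add[OF additive_flift]
        additive.zero[OF additive_flift] flift_fscale formal.scale_right_distrib algebra_simps)
  note sub = formal.subspace_add[OF tens3_rel_subspace] formal.subspace_scale[OF tens3_rel_subspace]
    formal.subspace_0[OF tens3_rel_subspace]
  have "in_del_tens3 act 0"
    unfolding in_del_tens3_def tens3_eq_def
    by (rule exI[of _ 0]) (simp only: D(3) diff_self sub(3))
  moreover have "in_del_tens3 act (s + s')" if "in_del_tens3 act s" "in_del_tens3 act s'" for s s'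
  proof -
    obtain t t' where "s - ?D t \<in> tens3_rel act" "s' - ?D t' \<in> tens3_rel act"
      using \<open>in_del_tens3 act s\<close> \<open>in_del_tens3 act s'\<close>
      unfolding in_del_tens3_def tens3_eq_def by blast
    from sub(1)[OF this] show ?thesis
      unfolding in_del_tens3_def tens3_eq_def
      by (intro exI[of _ "t + t'"]) (simp only: D(1) add_diff_add)
  qed
  moreover have "in_del_tens3 act (fscale c s)" if s: "in_del_tens3 act s" for c s
  proof -
    obtain t where "s - ?D t \<in> tens3_rel act"
      using s unfolding in_del_tens3_def tens3_eq_def by blast
    from sub(2)[OF this, of c] show ?thesis
      unfolding in_del_tens3_def tens3_eq_def
      by (intro exI[of _ "fscale c t"]) (simp only: D(2) formal.scale_right_diff_distrib)
  qed
  ultimately show ?thesis by (simp add: formal.subspace_def)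
qed

lemma in_del_tens3_if_rel: "s \<in> tens3_rel act \<Longrightarrow> in_del_tens3 act s"
  unfolding in_del_tens3_def tens3_eq_def
  by (rule exI[of _ 0]) (simp add: dII_def IdI_def IId_def additive.zero[OF additive_flift])

lemma in_del_tens3_del:
  "in_del_tens3 act (tens3 (kd_del act a) b c + tens3 a (kd_del act b) c + tens3 a b (kd_del act c))"
  unfolding in_del_tens3_def tens3_eq_def
  by (rule exI[of _ "tens3 a b c"])
    (simp add: dII_def IdI_def IId_def tens3_def formal.subspace_0[OF tens3_rel_subspace])

text \<open>
  Monomial tensors without \<open>\<partial>\<close> on the third factor; with basis elements as factors they represent a
  \<open>k\<close>-basis of the quotient of \<open>P\<otimes>P\<otimes>P\<close> by the image of \<open>\<partial>\<close>.
\<close>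
definition reduced_tensor :: "(nat \<times> nat) \<times> ('p \<times> 'p \<times> 'p) \<Rightarrow> ('p \<times> 'p \<times> 'p) \<Rightarrow>\<^sub>0 'k" where
  "reduced_tensor = (\<lambda>((i, j), (a, b, c)). tens3 (act (monom 1 i) a) (act (monom 1 j) b) c)"

text \<open>
  The relation \<open>a\<otimes>b\<otimes>\<partial>c \<equiv> -(\<partial>a\<otimes>b\<otimes>c) - (a\<otimes>\<partial>b\<otimes>c)\<close> removes powers of \<open>\<partial>\<close> from the third factor one
  at a time, at the cost of arbitrary first and second factors. Hence these must already be
  treated in general when the third factor is a basis element.
\<close>
lemma reduced_span:
  "s \<in> module.span fscale ({s. in_del_tens3 act s} \<union>
     reduced_tensor ` (UNIV \<times> (basis \<times> basis \<times> basis)))" (is "s \<in> module.span fscale ?S")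
proof -
  let ?W = "formal.span ?S"
  have del: "t \<in> ?W" if "in_del_tens3 act t" for t
    using that by (intro formal.span_base) auto
  have rel: "t \<in> ?W" if "t \<in> tens3_rel act" for t
    using that by (intro del in_del_tens3_if_rel)
  have W_diff: "t \<in> ?W" if "t - t' \<in> ?W" "t' \<in> ?W" for t t'
    using formal.span_add[OF that] by simp
  note gen = rel[unfolded tens3_rel_def, OF formal.span_base]
  have add: "tens3 (a + a') b c \<in> ?W" if "tens3 a b c \<in> ?W" "tens3 a' b c \<in> ?W" for a a' b c
  proof -
    have "tens3 (a + a') b c - tens3 a b c - tens3 a' b c \<in> ?W" by (rule gen, rule UnI1, rule UnI1, rule UnI1, rule UnI1, rule UnI1, blast)
    from W_diff[OF W_diff[OF this that(2)] that(1)] show ?thesis .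
  qed
  have add2: "tens3 a (b + b') c \<in> ?W" if "tens3 a b c \<in> ?W" "tens3 a b' c \<in> ?W" for a b b' c
  proof -
    have "tens3 a (b + b') c - tens3 a b c - tens3 a b' c \<in> ?W" by (rule gen, rule UnI1, rule UnI1, rule UnI1, rule UnI1, rule UnI2, blast)
    from W_diff[OF W_diff[OF this that(2)] that(1)] show ?thesis .
  qed
  have add3: "tens3 a b (c + c') \<in> ?W" if "tens3 a b c \<in> ?W" "tens3 a b c' \<in> ?W" for a b c c'
  proof -
    have "tens3 a b (c + c') - tens3 a b c - tens3 a b c' \<in> ?W" by (rule gen, rule UnI1, rule UnI1, rule UnI1, rule UnI2, blast)
    from W_diff[OF W_diff[OF this that(2)] that(1)] show ?thesis .
  qed
  have scale: "tens3 (act [:k:] a) b c \<in> ?W" if "tens3 a b c \<in> ?W" for k a b c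
  proof -
    have "tens3 (act [:k:] a) b c - fscale k (tens3 a b c) \<in> ?W" by (rule gen, rule UnI1, rule UnI1, rule UnI2, blast)
    from W_diff[OF this formal.span_scale[OF that]] show ?thesis .
  qed
  have scale2: "tens3 a (act [:k:] b) c \<in> ?W" if "tens3 a b c \<in> ?W" for k a b c
  proof -
    have "tens3 a (act [:k:] b) c - fscale k (tens3 a b c) \<in> ?W" by (rule gen, rule UnI1, rule UnI2, blast)
    from W_diff[OF this formal.span_scale[OF that]] show ?thesis .
  qed
  have scale3: "tens3 a b (act [:k:] c) \<in> ?W" if "tens3 a b c \<in> ?W" for k a b c
  proof -
    have "tens3 a b (act [:k:] c) - fscale k (tens3 a b c) \<in> ?W" by (rule gen, rule UnI2, blast)
    from W_diff[OF this formal.span_scale[OF that]] show ?thesis .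
  qed
  have zero: "tens3 0 b c \<in> ?W" "tens3 a 0 c \<in> ?W" "tens3 a b 0 \<in> ?W" for a b c
  proof -
    have "tens3 (act [:0:] 0) b c - fscale 0 (tens3 0 b c) \<in> ?W"
      by (rule gen, rule UnI1, rule UnI1, rule UnI2, blast)
    moreover have "tens3 a (act [:0:] 0) c - fscale 0 (tens3 a 0 c) \<in> ?W"
      by (rule gen, rule UnI1, rule UnI2, blast)
    moreover have "tens3 a b (act [:0:] 0) - fscale 0 (tens3 a b 0) \<in> ?W"
      by (rule gen, rule UnI2, blast)
    ultimately show "tens3 0 b c \<in> ?W" "tens3 a 0 c \<in> ?W" "tens3 a b 0 \<in> ?W" by simp_all
  qed
  have basis3: "tens3 a b c \<in> ?W" if c: "c \<in> basis" for a b c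
  proof (induction a rule: kd_induct)
    case (basis i a)
    then show ?case
    proof (induction b rule: kd_induct)
      case (basis j b)
      then have "reduced_tensor ((i, j), (a, b, c)) \<in> ?W"
        using c by (intro formal.span_base) auto
      then show ?case by (simp add: reduced_tensor_def)
    qed (auto intro: zero add2 scale2)
  qed (auto intro: zero add scale)
  have "tens3 a b c \<in> ?W" for a b c
  proof (induction c arbitrary: a b rule: kd_induct)
    case (basis i c)
    show ?case
    proof (induction i arbitrary: a b)
      case 0
      then show ?case using basis3[OF basis] by (simp add: one_pCons[symmetric] monom_0)
    next
      case (Suc i)
      let ?c = "act (monom 1 i) c"
      have "act (monom 1 (Suc i)) c = kd_del act ?c"
        by (simp add: monom_Suc)
      \<comment> \<open>the sum of the three tensors with one extra \<open>\<partial>\<close> lies in the image\<close>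
      moreover have "tens3 a b (kd_del act ?c) \<in> ?W"
        using formal.span_diff[OF formal.span_diff[OF del[OF in_del_tens3_del[of a b ?c]]
            Suc.IH[of "kd_del act a" b]] Suc.IH[of a "kd_del act b"]]
        by simp
      ultimately show ?case by simp
    qed
  qed (auto intro: zero add3 scale3)
  then have "(\<Sum>x\<in>Poly_Mapping.keys s.
      fscale (Poly_Mapping.lookup s x) (Poly_Mapping.single x 1)) \<in> ?W"
    by (intro formal.span_sum formal.span_scale) (auto simp: tens3_def)
  then show ?thesis by (simp only: formal_sum[symmetric])
qed

text \<open>
  Modulo the image, \<open>s\<close> is a combination of reduced tensors. The coordinate functions of a triple
  of basis elements, at \<open>\<alpha>\<close>, \<open>\<beta>\<close> and \<open>-\<alpha>-\<beta>\<close>, turn \<open>s\<close> into the polynomial in \<open>\<alpha>\<close> and \<open>\<beta>\<close> formed by its coefficients at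
  that triple, so all coefficients vanish.
\<close>
theorem in_del_tens3I:
  assumes "\<And>f g h \<alpha> \<beta> \<gamma>. f \<in> cdual act UNIV \<Longrightarrow> g \<in> cdual act UNIV \<Longrightarrow> h \<in> cdual act UNIV \<Longrightarrow>
    \<alpha> + \<beta> + \<gamma> = 0 \<Longrightarrow>
    pair3 (\<lambda>x. poly (f x) \<alpha>) (\<lambda>x. poly (g x) \<beta>) (\<lambda>x. poly (h x) \<gamma>) s = 0"
  shows "in_del_tens3 act s"
proof -
  obtain m y where my: "s = m + y" "in_del_tens3 act m"
    and y: "y \<in> formal.span (reduced_tensor ` (UNIV \<times> (basis \<times> basis \<times> basis)))"
    using reduced_span[of s] formal.span_eq_iff[THEN iffD2, OF subspace_in_del_tens3]
    unfolding formal.span_Un by auto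
  obtain T u where T: "finite T" "T \<subseteq> reduced_tensor ` (UNIV \<times> (basis \<times> basis \<times> basis))"
    and yT: "y = (\<Sum>t\<in>T. fscale (u t) t)"
    using y unfolding formal.span_explicit by blast
  \<comment> \<open>On \<open>J\<close> no reduced tensor is repeated, so the sum over \<open>T\<close> becomes a sum over indices.\<close>
  obtain J where J: "J \<subseteq> UNIV \<times> (basis \<times> basis \<times> basis)" "inj_on reduced_tensor J"
    "T = reduced_tensor ` J"
    using T(2) by (auto simp: subset_image_inj)
  have finJ: "finite J" using T(1) J by (simp add: finite_image_iff)
  define v where "v j = u (reduced_tensor j)" for j
  have yJ: "y = (\<Sum>j\<in>J. fscale (v j) (reduced_tensor j))"
    unfolding yT J(3) v_def by (simp add: sum.reindex[OF J(2)])
  have "v (ij, b1, b2, b3) = 0" if inJ: "(ij, b1, b2, b3) \<in> J" for ij b1 b2 b3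
  proof -
    let ?J = "{ij. (ij, b1, b2, b3) \<in> J}"
    have "(\<Sum>(i, j)\<in>?J. v ((i, j), b1, b2, b3) * (x ^ i * z ^ j)) = 0" for x z
    proof -
      note e = eigenfunctional_cdual[OF module_axioms coord_in_cdual]
      let ?p = "pair3 (\<lambda>a. poly (coord b1 a) x) (\<lambda>a. poly (coord b2 a) z)
        (\<lambda>a. poly (coord b3 a) (- x - z))"
      note add = additive_pair3[of "\<lambda>a. poly (coord b1 a) x" "\<lambda>a. poly (coord b2 a) z"
        "\<lambda>a. poly (coord b3 a) (- x - z)"]
      have "?p s = 0" by (intro assms coord_in_cdual) simp
      moreover have "?p m = 0" by (rule pair3_in_del_tens3[OF e e e _ my(2)]) simp
      ultimately have "?p y = 0" by (simp add: my(1) additive.add[OF add])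
      moreover have "?p (fscale (v j) (reduced_tensor j))
          = (case j of ((m, n), c) \<Rightarrow> if c = (b1, b2, b3) then v j * (x ^ m * z ^ n) else 0)"
        if "j \<in> J" for j
        using that J(1)
        by (auto simp: reduced_tensor_def pair3_def tens3_def eigenfunctional_act[OF e] poly_monom
            coord_basis split: prod.split)
      ultimately have "(\<Sum>j\<in>J. case j of ((m, n), c) \<Rightarrow>
          if c = (b1, b2, b3) then v j * (x ^ m * z ^ n) else 0) = 0"
        unfolding yJ by (simp add: additive.sum[OF add])
      also have "(\<Sum>j\<in>J. case j of ((m, n), c) \<Rightarrow>
          if c = (b1, b2, b3) then v j * (x ^ m * z ^ n) else 0)
        = (\<Sum>j\<in>(\<lambda>ij. (ij, b1, b2, b3)) ` ?J. case j of ((m, n), c) \<Rightarrow> v j * (x ^ m * z ^ n))"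
        by (rule sum.mono_neutral_cong_right) (auto simp: finJ)
      also have "\<dots> = (\<Sum>(i, j)\<in>?J. v ((i, j), b1, b2, b3) * (x ^ i * z ^ j))"
        by (subst sum.reindex) (auto simp: inj_on_def case_prod_beta intro!: sum.cong)
      finally show ?thesis .
    qed
    moreover have "finite ?J"
      using finite_vimageI[OF finJ, of "\<lambda>ij. (ij, b1, b2, b3)"] by (simp add: inj_on_def vimage_def)
    ultimately show ?thesis
      using bivariate_coeffs_zero[of ?J "\<lambda>ij. v (ij, b1, b2, b3)" ij] inJ by simp
  qed
  then have "y = 0" unfolding yJ by (intro sum.neutral) auto
  then show ?thesis using my by simp
qed

end

section \<open>The operator of a tensor\<close>

lemma zero_sum_solve:
  fixes \<alpha> \<beta> \<gamma> :: "'k::field_char_0"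
  assumes "\<alpha> + \<beta> + \<gamma> = 0"
  shows "- \<beta> - \<gamma> = \<alpha>" "- \<gamma> - \<beta> = \<alpha>" "- \<alpha> - \<gamma> = \<beta>" "- \<gamma> - \<alpha> = \<beta>" "- \<alpha> - \<beta> = \<gamma>"
proof -
  have "\<gamma> = - (\<alpha> + \<beta>)"
    using assms by (metis add.commute eq_neg_iff_add_eq_0)
  then show "- \<beta> - \<gamma> = \<alpha>" "- \<gamma> - \<beta> = \<alpha>" "- \<alpha> - \<gamma> = \<beta>" "- \<gamma> - \<alpha> = \<beta>" "- \<alpha> - \<beta> = \<gamma>"
    by simp_all
qed

lemma (in free_kd_module) eigenfunctional_T:
  assumes "eigenfunctional act \<gamma> \<phi>"
  shows "\<phi> (coeff (T_of act I r l f) 0) = (\<Sum>i\<in>I. poly (f (r i)) (- \<gamma>) * \<phi> (l i))"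
proof -
  note add = additive_evalp[OF eigenfunctional_additive[OF assms]]
  have "\<phi> (coeff q 0) = evalp \<phi> 0 q" for q
    by (simp add: evalp_poly eigenfunctional_zero[OF assms] poly_0_coeff_0 coeff_map_poly)
  moreover have "evalp \<phi> 0 (psubst (- lam1 - del1 act) (\<lambda>c. emb1 (act [:c:] x)) q)
      = evalp (\<lambda>c. evalp \<phi> 0 (emb1 (act [:c:] x))) (- 0 - \<gamma>) q" for x q
    by (rule additive_psubst[OF add]) (rule evalp_reflect[OF module_axioms assms])
  ultimately show ?thesis
    by (simp only: T_of_def additive.sum[OF add] evalp_const eigenfunctional_act[OF assms]
        evalp_coefficients) simp
qed

context free_poisson
begin

context
  fixes I :: "'i set" and r l :: "'i \<Rightarrow> 'p" and T
  defines "T \<equiv> \<lambda>f. coeff (T_of act I r l f) 0"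
begin

lemma T_eval:
  "eigenfunctional act \<gamma> \<phi> \<Longrightarrow> \<phi> (T f) = (\<Sum>i\<in>I. poly (f (r i)) (- \<gamma>) * \<phi> (l i))"
  unfolding T_def by (rule eigenfunctional_T)

lemma T_hom: "kd_hom_on cdual_act (cdual act UNIV) act T"
  unfolding kd_hom_on_def
proof (intro conjI ballI allI)
  fix f g
  show "T (f + g) = T f + T g"
  proof (rule cdual_separates)
    fix h \<gamma> assume "h \<in> cdual act UNIV"
    note e = eigenfunctional_cdual[OF module_axioms this]
    show "poly (h (T (f + g))) \<gamma> = poly (h (T f + T g)) \<gamma>"
      by (simp only: T_eval[OF e] additive.add[OF eigenfunctional_additive[OF e]])
        (simp add: algebra_simps sum.distrib)
  qed
next
  fix p f
  show "T (cdual_act p f) = act p (T f)"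
  proof (rule cdual_separates)
    fix h \<gamma> assume "h \<in> cdual act UNIV"
    note e = eigenfunctional_cdual[OF module_axioms this]
    show "poly (h (T (cdual_act p f))) \<gamma> = poly (h (act p (T f))) \<gamma>"
      by (simp only: T_eval[OF e] eigenfunctional_act[OF e])
        (simp add: poly_cdual_act sum_distrib_left mult_ac)
  qed
qed

lemma T_zero: "T 0 = 0"
proof (rule cdual_separates)
  fix h \<gamma> assume "h \<in> cdual act UNIV"
  note e = eigenfunctional_cdual[OF module_axioms this]
  show "poly (h (T 0)) \<gamma> = poly (h 0) \<gamma>"
    by (simp only: T_eval[OF e] eigenfunctional_zero[OF e]) simp
qed

lemma eigenfunctional_comp_T:
  assumes "eigenfunctional act \<gamma> \<phi>"
  shows "eigenfunctional cdual_act \<gamma> (\<lambda>f. \<phi> (T f))"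
  unfolding T_eval[OF assms]
  by (auto simp: eigenfunctional_def additive_def poly_cdual_act algebra_simps sum.distrib
      sum_distrib_left)

text \<open>
  In the next three lemmas \<open>\<alpha>\<close> is the value of \<open>\<lambda>\<close>, and \<open>\<beta>\<close> stands for \<open>-\<alpha>-\<gamma>\<close>: the two arguments of
  \<open>h\<^sub>\<gamma>(a\<^sub>\<alpha> b)\<close> see \<open>\<partial>\<close> as \<open>-\<alpha>\<close> and as \<open>\<alpha>+\<gamma> = -\<beta>\<close>, which \<open>T\<close> turns into \<open>f\<^sub>\<alpha>\<close> and \<open>g\<^sub>\<beta>\<close>.
\<close>
lemma T_product_eval:
  assumes "conformal_product act m" "eigenfunctional act \<gamma> H" "\<alpha> + \<beta> + \<gamma> = 0"
  shows "evalp H \<alpha> (m (T f) (T g)) = (\<Sum>i\<in>I. \<Sum>j\<in>I.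
    poly (f (r i)) \<alpha> * poly (g (r j)) \<beta> * evalp H \<alpha> (m (l i) (l j)))"
proof -
  have \<beta>: "- (\<alpha> + \<gamma>) = \<beta>"
    using zero_sum_solve(3)[OF assms(3)] by simp
  have "evalp H \<alpha> (m (T f) (T g))
      = (\<Sum>i\<in>I. poly (f (r i)) \<alpha> * evalp H \<alpha> (m (l i) (T g)))"
    using T_eval[OF eigenfunctional_left[OF assms(1,2)]] by simp
  then show ?thesis
    by (simp only: T_eval[OF eigenfunctional_right[OF assms(1,2)]] \<beta> minus_minus sum_distrib_left mult.assoc)
qed

lemma T_action_eval:
  assumes "conformal_product act m" "contragredient act \<epsilon> m D" "g \<in> cdual act UNIV"
    and "eigenfunctional act \<gamma> H" "\<alpha> + \<beta> + \<gamma> = 0"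
  shows "evalp H \<alpha> (map_poly T (D (T f) g)) = \<epsilon> * (\<Sum>i\<in>I. \<Sum>j\<in>I.
    poly (f (r i)) \<alpha> * evalp (\<lambda>x. poly (g x) \<beta>) \<alpha> (m (l i) (r j)) * H (l j))"
proof -
  have \<beta>: "- \<gamma> - \<alpha> = \<beta>"
    using zero_sum_solve[OF assms(5)] by simp
  note e = eigenfunctional_cdual[OF module_axioms assms(3), of \<beta>]
  have "evalp H \<alpha> (map_poly T (D (T f) g))
      = evalp (\<lambda>F. \<Sum>j\<in>I. H (l j) * poly (F (r j)) (- \<gamma>)) \<alpha> (D (T f) g)"
    by (simp add: evalp_map_poly T_zero eigenfunctional_zero[OF assms(4)] T_eval[OF assms(4)]
        mult.commute)
  also have "\<dots> = (\<Sum>j\<in>I. H (l j) * (\<epsilon> * evalp (\<lambda>x. poly (g x) \<beta>) \<alpha> (m (T f) (r j))))"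
    by (simp only: evalp_functional_sum evalp_functional_scale
        evalp_contragredient[OF assms(2,3)] \<beta>)
  also have "\<dots> = (\<Sum>j\<in>I. \<Sum>i\<in>I. \<epsilon> *
    (poly (f (r i)) \<alpha> * evalp (\<lambda>x. poly (g x) \<beta>) \<alpha> (m (l i) (r j)) * H (l j)))"
    by (simp add: T_eval[OF eigenfunctional_left[OF assms(1) e]] sum_distrib_left mult_ac)
  finally show ?thesis
    by (subst (asm) sum.swap) (simp add: sum_distrib_left)
qed

text \<open>
  The reflection \<open>-\<lambda>-\<partial>\<close> moves the evaluation from \<open>\<alpha>\<close> to \<open>\<beta>\<close>, so this is the preceding contraction
  with the roles of \<open>f\<close>, \<open>\<alpha>\<close> and \<open>g\<close>, \<open>\<beta>\<close> exchanged.
\<close>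
lemma T_reflected_action_eval:
  assumes "conformal_product act m" "contragredient act \<epsilon> m D" "f \<in> cdual act UNIV"
    and "eigenfunctional act \<gamma> H" "\<alpha> + \<beta> + \<gamma> = 0"
  shows "evalp H \<alpha> (map_poly T (psubst (- lam1 - del1 cdual_act) emb1 (D (T g) f)))
    = \<epsilon> * (\<Sum>i\<in>I. \<Sum>j\<in>I.
      evalp (\<lambda>x. poly (f x) \<alpha>) \<beta> (m (l i) (r j)) * poly (g (r i)) \<beta> * H (l j))"
proof -
  have \<beta>: "- \<alpha> - \<gamma> = \<beta>"
    using zero_sum_solve[OF assms(5)] by simp
  have "evalp H \<alpha> (map_poly T (psubst (- lam1 - del1 cdual_act) emb1 (D (T g) f)))
      = evalp (\<lambda>F. H (T F)) \<alpha> (psubst (- lam1 - del1 cdual_act) emb1 (D (T g) f))"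
    by (simp add: evalp_map_poly T_zero eigenfunctional_zero[OF assms(4)])
  also have "\<dots> = evalp (\<lambda>F. H (T F)) \<beta> (D (T g) f)"
    by (simp only: evalp_psubst_reflect[OF module_cdual_act eigenfunctional_comp_T[OF assms(4)]] \<beta>)
  also have "\<dots> = evalp H \<beta> (map_poly T (D (T g) f))"
    by (simp add: evalp_map_poly T_zero eigenfunctional_zero[OF assms(4)])
  also have "\<dots> = \<epsilon> * (\<Sum>i\<in>I. \<Sum>j\<in>I.
      poly (g (r i)) \<beta> * evalp (\<lambda>x. poly (f x) \<alpha>) \<beta> (m (l i) (r j)) * H (l j))"
    by (rule T_action_eval[OF assms(1,2,3,4)]) (use assms(5) in \<open>simp add: add_ac\<close>)
  finally show ?thesis by (simp add: mult.commute)
qed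

context
  assumes skew_tensor: "skew_symmetric_tensor act I r l"
begin

text \<open>
  Only the term of \<open>[[r,r]]\<close> and \<open>r\<bullet>r\<close> with a product in the first factor has to be
  reshaped by skew-symmetry of \<open>r\<close>; the others match after (skew-)commutativity of the product at most.
\<close>
lemma skew_first_term:
  assumes "conformal_product act m" "eigenfunctional act \<alpha> F" "eigenfunctional act \<beta> G"
  shows "(\<Sum>i\<in>I. \<Sum>j\<in>I. evalp F \<beta> (m (r i) (r j)) * G (l i) * H (l j))
    = - (\<Sum>i\<in>I. \<Sum>j\<in>I. evalp F \<beta> (m (l i) (r j)) * G (r i) * H (l j))"
proof -
  have "(\<Sum>i\<in>I. evalp F \<beta> (m (r i) x) * G (l i)) = - (\<Sum>i\<in>I. evalp F \<beta> (m (l i) x) * G (r i))"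
    for x
    by (rule skew_contraction[OF skew_tensor eigenfunctional_left[OF assms(1,2)] assms(3)])
  then have "(\<Sum>j\<in>I. (\<Sum>i\<in>I. evalp F \<beta> (m (r i) (r j)) * G (l i)) * H (l j))
    = - (\<Sum>j\<in>I. (\<Sum>i\<in>I. evalp F \<beta> (m (l i) (r j)) * G (r i)) * H (l j))"
    by (simp add: sum_negf)
  then show ?thesis
    by (subst (1 2) sum.swap) (simp only: sum_distrib_right)
qed

lemma yb_bracket_eval:
  assumes f: "f \<in> cdual act UNIV" and g: "g \<in> cdual act UNIV" and h: "h \<in> cdual act UNIV"
    and sum0: "\<alpha> + \<beta> + \<gamma> = 0"
  shows "pair3 (\<lambda>x. poly (f x) \<alpha>) (\<lambda>x. poly (g x) \<beta>) (\<lambda>x. poly (h x) \<gamma>) (yb_bracket act br I r l)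
    = evalp (\<lambda>x. poly (h x) \<gamma>) \<alpha> (br (T f) (T g))
      - evalp (\<lambda>x. poly (h x) \<gamma>) \<alpha> (map_poly T (coad (T f) g)
          - map_poly T (psubst (- lam1 - del1 cdual_act) emb1 (coad (T g) f)))"
proof -
  note e = eigenfunctional_cdual[OF module_axioms]
  have \<alpha>: "- \<gamma> - \<beta> = \<alpha>" "- \<beta> - \<gamma> = \<alpha>"
    using zero_sum_solve[OF sum0] by simp_all
  show ?thesis
    by (simp add: pair3_yb_bracket[OF e[OF f] e[OF g] e[OF h]]
        T_product_eval[OF product_br e[OF h] sum0]
        T_action_eval[OF product_br coad g e[OF h] sum0]
        T_reflected_action_eval[OF product_br coad f e[OF h] sum0]
        additive.diff[OF additive_evalp[OF eigenfunctional_additive[OF e[OF h]]]]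
        sum_subtractf sum.distrib skew_first_term[OF product_br e[OF f, of \<alpha>] e[OF g, of \<beta>], of "\<lambda>x. poly (h x) \<gamma>"]
        skew_eval[OF e[OF g, of \<beta>], of \<gamma>] skew_eval[OF e[OF h, of \<gamma>], of \<beta>] \<alpha> sum_negf)
qed

lemma yb_prod_eval:
  assumes f: "f \<in> cdual act UNIV" and g: "g \<in> cdual act UNIV" and h: "h \<in> cdual act UNIV"
    and sum0: "\<alpha> + \<beta> + \<gamma> = 0"
  shows "pair3 (\<lambda>x. poly (f x) \<alpha>) (\<lambda>x. poly (g x) \<beta>) (\<lambda>x. poly (h x) \<gamma>) (yb_prod act mul I r l)
    = evalp (\<lambda>x. poly (h x) \<gamma>) \<alpha> (mul (T f) (T g))
      - evalp (\<lambda>x. poly (h x) \<gamma>) \<alpha> (map_poly T (dual_mul (T f) g)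
          + map_poly T (psubst (- lam1 - del1 cdual_act) emb1 (dual_mul (T g) f)))"
proof -
  note e = eigenfunctional_cdual[OF module_axioms]
  have \<gamma>: "- \<alpha> - \<beta> = \<gamma>" and \<alpha>: "- \<gamma> - \<beta> = \<alpha>"
    using zero_sum_solve[OF sum0] by simp_all
  have comm: "evalp (\<lambda>x. poly (g x) \<beta>) \<gamma> (mul (r j) (l i))
      = evalp (\<lambda>x. poly (g x) \<beta>) \<alpha> (mul (l i) (r j))" for i j
    by (subst comm_eval[OF e[OF g]]) (simp only: \<alpha>)
  show ?thesis
    by (simp add: pair3_yb_prod[OF e[OF f] e[OF g] e[OF h]] \<gamma> comm
        T_product_eval[OF product_mul e[OF h] sum0]
        T_action_eval[OF product_mul dual_mul g e[OF h] sum0]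
        T_reflected_action_eval[OF product_mul dual_mul f e[OF h] sum0]
        additive.add[OF additive_evalp[OF eigenfunctional_additive[OF e[OF h]]]]
        sum_subtractf sum.distrib skew_first_term[OF product_mul e[OF f, of \<alpha>] e[OF g, of \<beta>], of "\<lambda>x. poly (h x) \<gamma>"])
qed

text \<open>
  Combines both criteria: vanishing pairings detect the image of \<open>\<partial>\<close>, and evaluations under \<open>h\<^sub>\<gamma>\<close>
  detect equality in \<open>P[\<lambda>]\<close>. Here \<open>\<alpha>\<close> and \<open>\<gamma>\<close> are arbitrary, as \<open>\<beta>\<close> is determined by them.
\<close>
lemma in_del_tens3_iff_T_identity:
  assumes "\<And>f g h \<alpha> \<beta> \<gamma>. f \<in> cdual act UNIV \<Longrightarrow> g \<in> cdual act UNIV \<Longrightarrow> h \<in> cdual act UNIV \<Longrightarrow>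
      \<alpha> + \<beta> + \<gamma> = 0 \<Longrightarrow>
      pair3 (\<lambda>x. poly (f x) \<alpha>) (\<lambda>x. poly (g x) \<beta>) (\<lambda>x. poly (h x) \<gamma>) s
      = evalp (\<lambda>x. poly (h x) \<gamma>) \<alpha> (L f g) - evalp (\<lambda>x. poly (h x) \<gamma>) \<alpha> (R f g)"
  shows "in_del_tens3 act s \<longleftrightarrow> (\<forall>f\<in>cdual act UNIV. \<forall>g\<in>cdual act UNIV. L f g = R f g)"
proof
  assume s: "in_del_tens3 act s"
  show "\<forall>f\<in>cdual act UNIV. \<forall>g\<in>cdual act UNIV. L f g = R f g"
  proof (intro ballI cdual_separates_polys)
    fix f g h \<gamma> \<alpha>
    assume fgh: "f \<in> cdual act UNIV" "g \<in> cdual act UNIV" "h \<in> cdual act UNIV"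
    note e = eigenfunctional_cdual[OF module_axioms]
    from pair3_in_del_tens3[OF e[OF fgh(1)] e[OF fgh(2)] e[OF fgh(3)] _ s,
        of \<alpha> "- \<alpha> - \<gamma>" \<gamma>] assms[OF fgh, of \<alpha> "- \<alpha> - \<gamma>" \<gamma>]
    show "evalp (\<lambda>x. poly (h x) \<gamma>) \<alpha> (L f g) = evalp (\<lambda>x. poly (h x) \<gamma>) \<alpha> (R f g)"
      by simp
  qed
next
  assume "\<forall>f\<in>cdual act UNIV. \<forall>g\<in>cdual act UNIV. L f g = R f g"
  then show "in_del_tens3 act s"
    by (intro in_del_tens3I) (simp add: assms)
qed

lemma pcybe_iff_o_operator:
  "pcybe_solution act br mul I r l \<longleftrightarrow>
    o_operator act br mul cdual_act (cdual act UNIV) coad dual_mul T"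
proof -
  have "in_del_tens3 act (yb_bracket act br I r l) \<longleftrightarrow>
    (\<forall>f\<in>cdual act UNIV. \<forall>g\<in>cdual act UNIV. br (T f) (T g) = map_poly T (coad (T f) g)
       - map_poly T (psubst (- lam1 - del1 cdual_act) emb1 (coad (T g) f)))"
    by (rule in_del_tens3_iff_T_identity, rule yb_bracket_eval)
  moreover have "in_del_tens3 act (yb_prod act mul I r l) \<longleftrightarrow>
    (\<forall>f\<in>cdual act UNIV. \<forall>g\<in>cdual act UNIV. mul (T f) (T g) = map_poly T (dual_mul (T f) g)
       + map_poly T (psubst (- lam1 - del1 cdual_act) emb1 (dual_mul (T g) f)))"
    by (rule in_del_tens3_iff_T_identity, rule yb_prod_eval)
  ultimately show ?thesis
    using coadjoint_representation T_hom
    unfolding pcybe_solution_def o_operator_def by argo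
qed

end

end

end

theorem proposition3p15:
  fixes act :: "'k::field_char_0 poly \<Rightarrow> 'p::ab_group_add \<Rightarrow> 'p"
    and br mul :: "'p \<Rightarrow> 'p \<Rightarrow> 'p poly"
    and I :: "'i set" and r l :: "'i \<Rightarrow> 'p"
  assumes "poisson_conformal_algebra act br mul"
    and "kd_free act"
    and "finite I"
    and "skew_symmetric_tensor act I r l"
  shows "pcybe_solution act br mul I r l \<longleftrightarrow>
    o_operator act br mul
      cdual_act (cdual act UNIV) (gc_dual br) (\<lambda>a f. - gc_dual mul a f)
      (\<lambda>f. coeff (T_of act I r l f) 0)"
proof -
  interpret poisson_conformal_algebra act br mul by fact
  interpret free_poisson act br mul
    by unfold_locales (rule assms(2))
  show ?thesis by (rule pcybe_iff_o_operator[OF assms(4)])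
qed

end
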